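(* Let $C$ be a commutative semigroup. Then: (1) For each $n$, $\mathbf{Sym}_n^{(C)}$ is a subalgebra of $\mathbf{FQSym}^{(C)}$ for the operation $*'$. (2) The restriction of $*'$ to $\mathbf{Sym}^{(C)}$ satisfies the splitting formula: for all $F_1,\ldots,F_r,G\in\mathbf{Sym}^{(C)}$, $$(F_1\cdots F_r)*'G=\mu_r\left[(F_1\otimes\cdots\otimes F_r)*'_r\Delta^{(r)}G\right],$$ where $\mu_r$ is the $r$-fold product map, $\Delta^{(r)}$ the $r$-fold coproduct, and $*'_r$ the componentwise extension of $*'$ to the $r$-th tensor power. (3) If the color semigroup is $C=\mathbb{N}$ (under addition), then for vectors $\mathbf{i}=(i_0,i_1,\ldots)$ and $\mathbf{j}=(j_0,j_1,\ldots)$ of the same weight $n$, $$S_{\mathbf{i}}*'S_{\mathbf{j}}=\sum_{\mathbf{n}}d_{\mathbf{i}\,\mathbf{j}}^{\mathbf{n}}\,S_{\mathbf{n}}\quad(|\mathbf{n}|=n),$$ where $d_{\mathbf{i}\,\mathbf{j}}^{\mathbf{n}}$ is the coefficient of the monomial symmetric function $m_\mu$ in the product $m_\alpha m_\beta$, with $\mu=(0^{n_0}1^{n_1}2^{n_2}\cdots)$, $\alpha=(0^{i_0}1^{i_1}2^{i_2}\cdots)$, $\beta=(0^{j_0}1^{j_1}2^{j_2}\cdots)$, the monomial functions being taken over an alphabet of $n$ letters. (4) For every vector $\mathbf{i}$ and every vector composition $\mathbf{J}$, $S^{\mathbf{i}}*'S^{\mathbf{J}}=S^{\mathbf{J}}*'S^{\mathbf{i}}$,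 where $S^{\mathbf{i}}=S_{\mathbf{i}}$.
   Context: $C$ is the (possibly infinite) color set, with semigroup law written multiplicatively in general. A colored permutation of size $n$ is a pair $(\sigma,u)$ with $\sigma\in\mathfrak{S}_n$, $u\in C^n$. Colored permutations of size $n$ are multiplied in the wreath product $C\wr\mathfrak{S}_n$ by $$(\sigma;c_1,\ldots,c_n)\cdot(\tau;d_1,\ldots,d_n)=(\sigma\tau;\ c_{\tau(1)}d_1,\ldots,c_{\tau(n)}d_n),\qquad (\sigma\tau)(i)=\sigma(\tau(i)).$$ $\mathbf{FQSym}^{(C)}$ is the graded Hopf algebra with basis $\mathbf{G}_{\sigma,u}$ indexed by colored permutations, with $$\mathbf{G}_{\sigma',u'}\mathbf{G}_{\sigma'',u''}=\sum_{\sigma\in\sigma'*\sigma''}\mathbf{G}_{\sigma,u'\cdot u''},\qquad \Delta\mathbf{G}_{\sigma,u}=\sum_{(\sigma,u)\in(\sigma',u')\Cup(\sigma'',u'')}\mathbf{G}_{\sigma',u'}\otimes\mathbf{G}_{\sigma'',u''}.$$ Here, for $\sigma'\in\mathfrak S_p$ and $\sigma''\in\mathfrak S_q$, $\sigma'*\sigma''$ (convolution) is the set of $\tau\in\mathfrak{S}_{p+q}$ such that the standardizations of the words formed by the first $p$ and the last $q$ letters of $\tau$ are $\sigma'$ and $\sigma''$ (the standardization of a word is the permutation with the same inversions); $u'\cdot u''$ is concatenation; and $(\sigma',u')\Cup(\sigma'',u'')$ is the shuffle of the words of biletters $(\sigma',u')$ and $(\sigma''[p],u'')$, where $\sigma''[p]$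 is $\sigma''$ with $p$ added to each letter (colors follow their letters). The operation $*'$ on $\mathbf{FQSym}^{(C)}$ is defined by $\mathbf{G}_{h'}*'\mathbf{G}_{h''}=\mathbf{G}_{h''h'}$ for $h',h''\in C\wr\mathfrak{S}_n$, and $0$ for colored permutations of different sizes. For a finitely supported vector $\mathbf{n}=(n_c)_{c\in C}$ of nonnegative integers with weight $|\mathbf{n}|=\sum_c n_c=n$, $$S_{\mathbf{n}}=\sum_{u\in C^n;\ |u|_c=n_c\ \forall c}\mathbf{G}_{12\cdots n,u}\qquad(S_{\mathbf{0}}=1),$$ where $|u|_c$ is the number of occurrences of $c$ in $u$. $\mathbf{Sym}^{(C)}$ is the subalgebra of $\mathbf{FQSym}^{(C)}$ generated by the $S_{\mathbf{n}}$ (it is a Hopf subalgebra), and $\mathbf{Sym}_n^{(C)}$ is its homogeneous component of degree $n$. A vector composition $\mathbf{J}=(\mathbf{j}_1,\ldots,\mathbf{j}_m)$ is a finite sequence of nonzero such vectors, and $S^{\mathbf{J}}=S_{\mathbf{j}_1}\cdots S_{\mathbf{j}_m}$. *)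

theory Defs
  imports "HOL-Library.Poly_Mapping" "HOL-Library.Multiset" "HOL-Combinatorics.Multiset_Permutations"
begin

section \<open>Finitely supported linear combinations\<close>

text \<open>The free module over a commutative ring with basis \<open>'a\<close> is the type of finitely supported
  maps \<open>'a \<Rightarrow>\<^sub>0 'k\<close>. The ring structure that the library puts on such maps is not used for the
  algebras below (it is used for ordinary polynomials at the end).\<close>

definition scale :: "'k::comm_ring_1 \<Rightarrow> ('a \<Rightarrow>\<^sub>0 'k) \<Rightarrow> ('a \<Rightarrow>\<^sub>0 'k)" where
  "scale a F = Poly_Mapping.map (\<lambda>x. a * x) F"

definition basis :: "'a \<Rightarrow> ('a \<Rightarrow>\<^sub>0 'k::comm_ring_1)" where
  "basis x = Poly_Mapping.single x 1"

definition lin_ext :: "('a \<Rightarrow> ('b \<Rightarrow>\<^sub>0 'k)) \<Rightarrow> ('a \<Rightarrow>\<^sub>0 'k) \<Rightarrow> ('b \<Rightarrow>\<^sub>0 'k::comm_ring_1)" where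
  "lin_ext \<phi> F = (\<Sum>x\<in>Poly_Mapping.keys F. scale (Poly_Mapping.lookup F x) (\<phi> x))"

definition bilin_ext ::
  "('a \<Rightarrow> 'b \<Rightarrow> ('d \<Rightarrow>\<^sub>0 'k)) \<Rightarrow> ('a \<Rightarrow>\<^sub>0 'k) \<Rightarrow> ('b \<Rightarrow>\<^sub>0 'k) \<Rightarrow> ('d \<Rightarrow>\<^sub>0 'k::comm_ring_1)" where
  "bilin_ext \<phi> F H = lin_ext (\<lambda>x. lin_ext (\<phi> x) H) F"

definition is_subalgebra ::
  "(('a \<Rightarrow>\<^sub>0 'k) \<Rightarrow> ('a \<Rightarrow>\<^sub>0 'k) \<Rightarrow> ('a \<Rightarrow>\<^sub>0 'k::comm_ring_1)) \<Rightarrow> ('a \<Rightarrow>\<^sub>0 'k) set \<Rightarrow> bool" where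
  "is_subalgebra m A \<longleftrightarrow>
     0 \<in> A \<and> (\<forall>F\<in>A. \<forall>H\<in>A. F + H \<in> A) \<and> (\<forall>a. \<forall>F\<in>A. scale a F \<in> A) \<and>
     (\<forall>F\<in>A. \<forall>H\<in>A. m F H \<in> A)"

section \<open>Colored permutations\<close>

text \<open>A colored permutation \<open>(\<sigma>, u)\<close> is its word of biletters: the first components spell
  \<open>\<sigma>\<close> in one-line notation with letters \<open>1, \<dots>, n\<close>, the second components spell \<open>u\<close>.\<close>

typedef 'c colperm = "{w :: (nat \<times> 'c) list. map fst w \<in> permutations_of_set {1..length w}}"
  morphisms biword Abs_colperm
  by (rule exI[of _ "[]"]) simp

setup_lifting type_definition_colperm

definition deg :: "'c colperm \<Rightarrow> nat" where
  "deg h = length (biword h)"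

definition perm :: "'c colperm \<Rightarrow> nat list" where
  "perm h = map fst (biword h)"

definition colors :: "'c colperm \<Rightarrow> 'c list" where
  "colors h = map snd (biword h)"

lift_definition id_colored :: "'c list \<Rightarrow> 'c colperm"
  is "\<lambda>u. zip [1..<Suc (length u)] u"
  by (auto simp: permutations_of_set_def map_fst_zip simp del: upt_Suc set_map)

text \<open>The product of the wreath product; the value for arguments of different sizes is a dummy.\<close>

lift_definition wreath_mult :: "('c \<Rightarrow> 'c \<Rightarrow> 'c) \<Rightarrow> 'c colperm \<Rightarrow> 'c colperm \<Rightarrow> 'c colperm"
  is "\<lambda>f g h. if length g = length h
        then map (\<lambda>(t, d). (fst (g ! (t - 1)), f (snd (g ! (t - 1))) d)) h
        else []"
proof -
  fix f :: "'c \<Rightarrow> 'c \<Rightarrow> 'c" and g h :: "(nat \<times> 'c) list"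
  assume g: "map fst g \<in> permutations_of_set {1..length g}"
    and h: "map fst h \<in> permutations_of_set {1..length h}"
  let ?m = "\<lambda>(t, d). (fst (g ! (t - 1)), f (snd (g ! (t - 1))) d)"
  have "map fst (map ?m h) \<in> permutations_of_set {1..length h}" if len: "length g = length h"
  proof -
    let ?s = "\<lambda>t. map fst g ! (t - 1)"
    have sh: "set (map fst h) = {1..length h}" "distinct (map fst h)"
      using h by (auto simp: permutations_of_set_def)
    have sg: "set (map fst g) = {1..length h}" "distinct (map fst g)"
      using g len by (auto simp: permutations_of_set_def)
    have eq: "map fst (map ?m h) = map ?s (map fst h)"
      unfolding map_map
    proof (rule map_cong[OF refl])
      fix x assume "x \<in> set h"
      then have "fst x \<in> {1..length h}" using sh(1) by (metis image_eqI list.set_map)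
      then show "(fst \<circ> ?m) x = (?s \<circ> fst) x"
        using len by (cases x) (auto simp: nth_map)
    qed
    have inj: "inj_on ?s {1..length h}"
    proof (rule inj_onI)
      fix a b assume "a \<in> {1..length h}" "b \<in> {1..length h}" "?s a = ?s b"
      then have "a - 1 = b - 1" "1 \<le> a" "1 \<le> b"
        using nth_eq_iff_index_eq[OF sg(2), of "a - 1" "b - 1"] len by auto
      then show "a = b" by linarith
    qed
    have "?s ` {1..length h} \<subseteq> set (map fst g)"
      using len by (auto intro!: nth_mem simp del: set_map nth_map simp: in_set_conv_nth)
    then have "?s ` {1..length h} = {1..length h}"
      using inj sg(1) by (metis finite_atLeastAtMost endo_inj_surj)
    then have "set (map ?s (map fst h)) = {1..length h}"
      using sh(1) by (metis set_map)
    moreover have "distinct (map ?s (map fst h))"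
      using sh inj by (metis distinct_map)
    ultimately show ?thesis
      unfolding eq permutations_of_set_def by blast
  qed
  then show "map fst (if length g = length h then map ?m h else [])
     \<in> permutations_of_set {1..length (if length g = length h then map ?m h else [])}"
    by simp
qed

definition inversions :: "nat list \<Rightarrow> (nat \<times> nat) set" where
  "inversions w = {(i, j). i < j \<and> j < length w \<and> w ! j < w ! i}"

definition std :: "nat list \<Rightarrow> nat list" where
  "std w = (THE s. s \<in> permutations_of_set {1..length w} \<and> inversions s = inversions w)"

definition convolution :: "nat list \<Rightarrow> nat list \<Rightarrow> nat list set" where
  "convolution s' s'' =
     {t \<in> permutations_of_set {1..length s' + length s''}.
        std (take (length s') t) = s' \<and> std (drop (length s') t) = s''}"

definition shift :: "nat \<Rightarrow> (nat \<times> 'c) list \<Rightarrow> (nat \<times> 'c) list" where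
  "shift p w = map (\<lambda>(t, c). (t + p, c)) w"

section \<open>The Hopf algebra of free colored quasi-symmetric functions\<close>

type_synonym ('c, 'k) fqsym = "'c colperm \<Rightarrow>\<^sub>0 'k"

definition G :: "'c colperm \<Rightarrow> ('c, 'k::comm_ring_1) fqsym" where
  "G h = basis h"

definition fq_one :: "('c, 'k::comm_ring_1) fqsym" where
  "fq_one = G (id_colored [])"

definition fq_mult ::
  "('c, 'k::comm_ring_1) fqsym \<Rightarrow> ('c, 'k) fqsym \<Rightarrow> ('c, 'k) fqsym" where
  "fq_mult = bilin_ext (\<lambda>h' h''.
     \<Sum>h\<in>{h. perm h \<in> convolution (perm h') (perm h'') \<and> colors h = colors h' @ colors h''}. G h)"

definition fq_prod :: "('c, 'k::comm_ring_1) fqsym list \<Rightarrow> ('c, 'k) fqsym" where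
  "fq_prod Fs = foldr fq_mult Fs fq_one"

text \<open>The tensor square has as basis the pairs of colored permutations, the \<open>r\<close>-th tensor power the
  lists of \<open>r\<close> of them. A biword that lies in a shuffle of two biwords with disjoint letters
  occurs in it exactly once, so the set of shuffles carries all multiplicities.\<close>

definition coproduct ::
  "('c, 'k::comm_ring_1) fqsym \<Rightarrow> ('c colperm \<times> 'c colperm \<Rightarrow>\<^sub>0 'k)" where
  "coproduct = lin_ext (\<lambda>h.
     \<Sum>(h', h'')\<in>{(h', h''). biword h \<in> shuffles (biword h') (shift (deg h') (biword h''))}.
       basis (h', h''))"

type_synonym ('c, 'k) fq_tensor = "'c colperm list \<Rightarrow>\<^sub>0 'k"

text \<open>\<open>iter_coproduct r\<close> maps to the \<open>r\<close>-th tensor power: the counit for \<open>r = 0\<close>, the identity for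
  \<open>r = 1\<close>, and then the coproduct is applied to the first tensor factor.\<close>

fun iter_coproduct :: "nat \<Rightarrow> ('c, 'k::comm_ring_1) fqsym \<Rightarrow> ('c, 'k) fq_tensor" where
  "iter_coproduct 0 F = scale (Poly_Mapping.lookup F (id_colored [])) (basis [])"
| "iter_coproduct (Suc 0) F = lin_ext (\<lambda>h. basis [h]) F"
| "iter_coproduct (Suc (Suc r)) F =
     lin_ext (\<lambda>hs. lin_ext (\<lambda>(h', h''). basis (h' # h'' # tl hs)) (coproduct (G (hd hs))))
       (iter_coproduct (Suc r) F)"

fun tensor :: "('c, 'k::comm_ring_1) fqsym list \<Rightarrow> ('c, 'k) fq_tensor" where
  "tensor [] = basis []"
| "tensor (F # Fs) = bilin_ext (\<lambda>h hs. basis (h # hs)) F (tensor Fs)"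

definition mu :: "('c, 'k::comm_ring_1) fq_tensor \<Rightarrow> ('c, 'k) fqsym" where
  "mu = lin_ext (\<lambda>hs. fq_prod (map G hs))"

section \<open>The operation \<open>*'\<close>\<close>

text \<open>The argument \<open>f\<close> is the semigroup law on the colors. Note the reversal of the arguments in
  the wreath product.\<close>

definition star_basis ::
  "('c \<Rightarrow> 'c \<Rightarrow> 'c) \<Rightarrow> 'c colperm \<Rightarrow> 'c colperm \<Rightarrow> ('c, 'k::comm_ring_1) fqsym" where
  "star_basis f h' h'' = (if deg h' = deg h'' then G (wreath_mult f h'' h') else 0)"

definition star ::
  "('c \<Rightarrow> 'c \<Rightarrow> 'c) \<Rightarrow> ('c, 'k::comm_ring_1) fqsym \<Rightarrow> ('c, 'k) fqsym \<Rightarrow> ('c, 'k) fqsym" where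
  "star f = bilin_ext (star_basis f)"

definition star_tensor ::
  "('c \<Rightarrow> 'c \<Rightarrow> 'c) \<Rightarrow> ('c, 'k::comm_ring_1) fq_tensor \<Rightarrow> ('c, 'k) fq_tensor \<Rightarrow> ('c, 'k) fq_tensor"
  where
  "star_tensor f = bilin_ext (\<lambda>hs ks.
     if length hs = length ks then tensor (map2 (star_basis f) hs ks) else 0)"

section \<open>The subalgebra generated by the \<open>S\<^sub>n\<close>\<close>

definition weight :: "('c \<Rightarrow>\<^sub>0 nat) \<Rightarrow> nat" where
  "weight v = (\<Sum>c\<in>Poly_Mapping.keys v. Poly_Mapping.lookup v c)"

definition S :: "('c \<Rightarrow>\<^sub>0 nat) \<Rightarrow> ('c, 'k::comm_ring_1) fqsym" where
  "S v = (\<Sum>u\<in>{u. length u = weight v \<and> (\<forall>c. count_list u c = Poly_Mapping.lookup v c)}.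
     G (id_colored u))"

lemma S_zero: "S (0 :: 'c \<Rightarrow>\<^sub>0 nat) = fq_one"
proof -
  have "{u :: 'c list. length u = weight (0 :: 'c \<Rightarrow>\<^sub>0 nat) \<and>
      (\<forall>c. count_list u c = Poly_Mapping.lookup (0 :: 'c \<Rightarrow>\<^sub>0 nat) c)} = {[]}"
    by (auto simp: weight_def)
  then show ?thesis
    unfolding S_def fq_one_def by (simp del: lookup_zero)
qed

text \<open>By \<open>S_zero\<close>, a subalgebra that contains all \<open>S v\<close> is unital.\<close>

definition Sym :: "('c, 'k::comm_ring_1) fqsym set" where
  "Sym = is_subalgebra fq_mult hull range S"

definition Sym_deg :: "nat \<Rightarrow> ('c, 'k::comm_ring_1) fqsym set" where
  "Sym_deg n = {F \<in> Sym. \<forall>h\<in>Poly_Mapping.keys F. deg h = n}"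

definition vector_composition :: "('c \<Rightarrow>\<^sub>0 nat) list \<Rightarrow> bool" where
  "vector_composition J \<longleftrightarrow> (\<forall>j\<in>set J. j \<noteq> 0)"

definition S_comp :: "('c \<Rightarrow>\<^sub>0 nat) list \<Rightarrow> ('c, 'k::comm_ring_1) fqsym" where
  "S_comp J = fq_prod (map S J)"

section \<open>Monomial symmetric functions over an alphabet of \<open>n\<close> letters\<close>

text \<open>A partition with zero parts allowed is a multiset; \<open>partition_of v\<close> is the partition
  \<open>(0^v\<^sub>0 1^v\<^sub>1 2^v\<^sub>2 \<dots>)\<close>. Polynomials in the letters \<open>x\<^sub>0, \<dots>, x\<^bsub>n - 1\<^esub>\<close> are finitely supported
  functions on exponent vectors, with the convolution product of the library.\<close>

definition partition_of :: "(nat \<Rightarrow>\<^sub>0 nat) \<Rightarrow> nat multiset" where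
  "partition_of v = (\<Sum>k\<in>Poly_Mapping.keys v. replicate_mset (Poly_Mapping.lookup v k) k)"

definition monomial_sym :: "nat \<Rightarrow> nat multiset \<Rightarrow> ((nat \<Rightarrow>\<^sub>0 nat) \<Rightarrow>\<^sub>0 int)" where
  "monomial_sym n \<mu> =
     (\<Sum>e\<in>{e. Poly_Mapping.keys e \<subseteq> {..<n} \<and> image_mset (Poly_Mapping.lookup e) (mset_set {..<n}) = \<mu>}.
        Poly_Mapping.single e 1)"

text \<open>The family of coefficients of a symmetric polynomial in the basis of the \<open>m\<^sub>\<mu>\<close>, where
  \<open>\<mu>\<close> runs over the partitions with exactly \<open>n\<close> parts (zeros included).\<close>

definition monomial_coeffs :: "nat \<Rightarrow> ((nat \<Rightarrow>\<^sub>0 nat) \<Rightarrow>\<^sub>0 int) \<Rightarrow> (nat multiset \<Rightarrow>\<^sub>0 int)" where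
  "monomial_coeffs n p =
     (THE a. (\<forall>\<mu>\<in>Poly_Mapping.keys a. size \<mu> = n) \<and>
        p = (\<Sum>\<mu>\<in>Poly_Mapping.keys a. scale (Poly_Mapping.lookup a \<mu>) (monomial_sym n \<mu>)))"

definition d_coeff :: "nat \<Rightarrow> (nat \<Rightarrow>\<^sub>0 nat) \<Rightarrow> (nat \<Rightarrow>\<^sub>0 nat) \<Rightarrow> (nat \<Rightarrow>\<^sub>0 nat) \<Rightarrow> int" where
  "d_coeff n i j v =
     Poly_Mapping.lookup (monomial_coeffs n
       (monomial_sym n (partition_of i) * monomial_sym n (partition_of j))) (partition_of v)"

end

theory Submission
  imports Defs
begin

text \<open>An element of \<open>FQSym\<close> is read as a function on words of biletters with distinct but otherwise
  arbitrary letters, through standardization. The product then becomes deconcatenation, and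
  \<open>F *' H\<close> becomes the right action of \<open>F\<close> on \<open>H\<close> by place permutation and multiplication of
  colors. Acting by a product \<open>F\<^sub>1 F\<^sub>2\<close> means unshuffling a word into two subwords, acting on each
  of them and concatenating the results. For a general \<open>H\<close> the sum of \<open>H\<close> over the shuffles of two
  words depends on the relative order of their letters, and the coproduct only sees pairs in which
  the letters of the first word are the smaller ones. For the \<open>S\<^sub>n\<close> this dependence is absent, because
  a shuffle is increasing only if both words are, and then for exactly one shuffle. This
  property is inherited by sums and products, hence holds on \<open>Sym\<close>, which gives the splitting
  formula with two factors, for arbitrary \<open>F\<^sub>1\<close> and \<open>F\<^sub>2\<close>; more factors follow by induction.

  The element \<open>S\<^sub>n *' S\<^sub>m\<close> is a sum over pointwise products of color words, where the number of
  factorizations of a word depends only on its content; for \<open>C = \<nat>\<close> these numbers are the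
  structure constants of monomial symmetric functions. Closure of \<open>Sym\<close> under \<open>*'\<close> follows
  by splitting the left factor down to a single \<open>S\<^sub>n\<close>, which commutes with everything under \<open>*'\<close>, and
  then splitting the other factor.\<close>

abbreviation coef :: "('a \<Rightarrow>\<^sub>0 'k::zero) \<Rightarrow> 'a \<Rightarrow> 'k" where
  "coef \<equiv> Poly_Mapping.lookup"

abbreviation supp :: "('a \<Rightarrow>\<^sub>0 'k::zero) \<Rightarrow> 'a set" where
  "supp \<equiv> Poly_Mapping.keys"

section \<open>Linear maps on finitely supported functions\<close>

lemma lookup_scale [simp]: "coef (scale a F) x = a * coef F x"
  unfolding scale_def by (simp add: Poly_Mapping.map.rep_eq when_def)

lemma lookup_basis: "coef (basis x) y = (if x = y then 1 else 0)"
  by (simp add: basis_def lookup_single when_def)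

lemma scale_one [simp]: "scale 1 F = F"
  and scale_zero_left [simp]: "scale 0 F = 0"
  and scale_zero_right [simp]: "scale a 0 = 0"
  and scale_add_right: "scale a (F + H) = scale a F + scale a H"
  and scale_add_left: "scale (a + b) F = scale a F + scale b F"
  and scale_scale: "scale a (scale b F) = scale (a * b) F"
  by (rule poly_mapping_eqI; simp add: lookup_add algebra_simps)+

lemma scale_sum: "scale a (\<Sum>i\<in>I. F i) = (\<Sum>i\<in>I. scale a (F i))"
  by (rule poly_mapping_eqI) (simp add: lookup_sum sum_distrib_left)

lemma keys_basis [simp]: "supp (basis x :: 'a \<Rightarrow>\<^sub>0 'k::comm_ring_1) = {x}"
  by (simp add: basis_def)

lemma expand_basis: "F = (\<Sum>x\<in>supp F. scale (coef F x) (basis x))"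
proof (rule poly_mapping_eqI)
  fix y
  show "coef F y = coef (\<Sum>x\<in>supp F. scale (coef F x) (basis x)) y"
    by (simp add: lookup_sum lookup_basis if_distrib sum.delta not_in_keys_iff_lookup_eq_zero
        cong: if_cong)
qed

definition linear_map :: "(('a \<Rightarrow>\<^sub>0 'k) \<Rightarrow> ('b \<Rightarrow>\<^sub>0 'k::comm_ring_1)) \<Rightarrow> bool" where
  "linear_map \<phi> \<longleftrightarrow> (\<forall>F H. \<phi> (F + H) = \<phi> F + \<phi> H) \<and> (\<forall>a F. \<phi> (scale a F) = scale a (\<phi> F))"

lemma linear_map_add: "linear_map \<phi> \<Longrightarrow> \<phi> (F + H) = \<phi> F + \<phi> H"
  and linear_map_scale: "linear_map \<phi> \<Longrightarrow> \<phi> (scale a F) = scale a (\<phi> F)"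
  by (auto simp: linear_map_def)

lemma linear_map_zero: "linear_map \<phi> \<Longrightarrow> \<phi> 0 = 0"
  using linear_map_scale[of \<phi> 0 0] by simp

lemma linear_map_sum: "linear_map \<phi> \<Longrightarrow> \<phi> (\<Sum>i\<in>I. F i) = (\<Sum>i\<in>I. \<phi> (F i))"
  by (induction I rule: infinite_finite_induct) (auto simp: linear_map_zero linear_map_add)

lemma linear_map_sum_list: "linear_map \<phi> \<Longrightarrow> \<phi> (\<Sum>i\<leftarrow>L. F i) = (\<Sum>i\<leftarrow>L. \<phi> (F i))"
  by (induction L) (auto simp: linear_map_zero linear_map_add)

lemma linear_map_eqI:
  assumes "linear_map \<phi>" "linear_map \<psi>" "\<And>x. \<phi> (basis x) = \<psi> (basis x)"
  shows "\<phi> F = \<psi> F"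
proof -
  have "\<phi> (\<Sum>x\<in>supp F. scale (coef F x) (basis x)) = \<psi> (\<Sum>x\<in>supp F. scale (coef F x) (basis x))"
    by (simp add: assms linear_map_sum linear_map_scale)
  then show ?thesis by (simp only: expand_basis[of F, symmetric])
qed

text \<open>Lets elements with different supports be summed over one common index set.\<close>

lemma lin_ext_superset:
  assumes "finite A" "supp F \<subseteq> A"
  shows "lin_ext \<phi> F = (\<Sum>x\<in>A. scale (coef F x) (\<phi> x))"
  unfolding lin_ext_def
  by (rule sum.mono_neutral_left) (use assms in \<open>auto simp: in_keys_iff\<close>)

lemma lin_ext_basis [simp]: "lin_ext \<phi> (basis x) = \<phi> x"
  unfolding lin_ext_def by (simp add: lookup_basis)

lemma linear_map_lin_ext: "linear_map (lin_ext \<phi>)"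
  unfolding linear_map_def
proof (intro conjI allI)
  fix F H :: "'a \<Rightarrow>\<^sub>0 'b" and a
  have *: "supp (F + H) \<subseteq> supp F \<union> supp H" "supp (scale a F) \<subseteq> supp F \<union> supp H"
    using keys_add[of F H] by (auto simp: in_keys_iff)
  show "lin_ext \<phi> (F + H) = lin_ext \<phi> F + lin_ext \<phi> H"
    by (subst (1 2 3) lin_ext_superset[where A = "supp F \<union> supp H"])
      (use * in \<open>auto simp: lookup_add scale_add_left sum.distrib\<close>)
  show "lin_ext \<phi> (scale a F) = scale a (lin_ext \<phi> F)"
    by (subst (1 2) lin_ext_superset[where A = "supp F \<union> supp H"])
      (use * in \<open>auto simp: scale_scale scale_sum\<close>)
qed

lemma lookup_lin_ext:
  assumes "finite A" "supp F \<subseteq> A"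
  shows "coef (lin_ext \<phi> F) y = (\<Sum>x\<in>A. coef F x * coef (\<phi> x) y)"
  by (simp add: lin_ext_superset[OF assms] lookup_sum)

lemma linear_map_comp: "linear_map \<phi> \<Longrightarrow> linear_map \<psi> \<Longrightarrow> linear_map (\<lambda>F. \<phi> (\<psi> F))"
  by (simp add: linear_map_def)

lemma linear_map_plus:
  "linear_map \<phi> \<Longrightarrow> linear_map \<psi> \<Longrightarrow> linear_map (\<lambda>F. \<phi> F + \<psi> F)"
  by (simp add: linear_map_def scale_add_right algebra_simps)

lemma linear_map_const_zero: "linear_map (\<lambda>F. 0)"
  by (simp add: linear_map_def)

lemma linear_map_sum_list_fun:
  "(\<And>i. i \<in> set L \<Longrightarrow> linear_map (\<phi> i)) \<Longrightarrow> linear_map (\<lambda>F. \<Sum>i\<leftarrow>L. \<phi> i F)"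
  by (induction L) (auto intro: linear_map_const_zero linear_map_plus)

lemma linear_map_lin_ext_fun:
  assumes "\<And>x. linear_map (\<phi> x)"
  shows "linear_map (\<lambda>F. lin_ext (\<lambda>x. \<phi> x F) H)"
  unfolding lin_ext_def linear_map_def
  by (simp add: assms linear_map_add linear_map_scale scale_add_right sum.distrib scale_sum
      scale_scale mult.commute)

lemma bilin_ext_basis_left: "bilin_ext \<phi> (basis x) = lin_ext (\<phi> x)"
  by (rule ext) (simp add: bilin_ext_def)

lemma bilin_ext_basis [simp]: "bilin_ext \<phi> (basis x) (basis y) = \<phi> x y"
  by (simp add: bilin_ext_def)

lemma linear_map_bilin_ext_left: "linear_map (\<lambda>F. bilin_ext \<phi> F H)"
  unfolding bilin_ext_def by (rule linear_map_lin_ext)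

lemma linear_map_bilin_ext_right: "linear_map (bilin_ext \<phi> F)"
  unfolding bilin_ext_def by (intro linear_map_lin_ext_fun linear_map_lin_ext)

lemmas linear_map_bilin_ext [intro] =
  linear_map_comp[OF linear_map_bilin_ext_left] linear_map_comp[OF linear_map_bilin_ext_right]

text \<open>Fixing one argument at a time reduces to \<open>linear_map_eqI\<close>. Identities
  between bilinear operations can thus be checked on basis elements.\<close>

lemma bilinear_eqI:
  assumes "\<And>H. linear_map (\<lambda>F. \<phi> F H)" "\<And>F. linear_map (\<phi> F)"
    and "\<And>H. linear_map (\<lambda>F. \<psi> F H)" "\<And>F. linear_map (\<psi> F)"
    and "\<And>x y. \<phi> (basis x) (basis y) = \<psi> (basis x) (basis y)"
  shows "\<phi> F H = \<psi> F H"
proof (rule linear_map_eqI[where F = F])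
  show "\<phi> (basis x) H = \<psi> (basis x) H" for x
    by (rule linear_map_eqI[OF assms(2,4,5)])
qed (rule assms)+

lemma linear_map_fq_mult_left: "linear_map (\<lambda>F. fq_mult F H)"
  unfolding fq_mult_def by (rule linear_map_bilin_ext_left)
lemma linear_map_fq_mult_right: "linear_map (fq_mult F)"
  unfolding fq_mult_def by (rule linear_map_bilin_ext_right)
lemma linear_map_star_left: "linear_map (\<lambda>F. star f F H)"
  unfolding star_def by (rule linear_map_bilin_ext_left)
lemma linear_map_star_right: "linear_map (star f F)"
  unfolding star_def by (rule linear_map_bilin_ext_right)
lemma linear_map_star_tensor_left: "linear_map (\<lambda>F. star_tensor f F H)"
  unfolding star_tensor_def by (rule linear_map_bilin_ext_left)
lemma linear_map_star_tensor_right: "linear_map (star_tensor f F)"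
  unfolding star_tensor_def by (rule linear_map_bilin_ext_right)
lemma linear_map_coproduct: "linear_map coproduct"
  unfolding coproduct_def by (rule linear_map_lin_ext)
lemma linear_map_mu: "linear_map mu"
  unfolding mu_def by (rule linear_map_lin_ext)

abbreviation tensor_Cons :: "('c, 'k::comm_ring_1) fqsym \<Rightarrow> ('c, 'k) fq_tensor \<Rightarrow> ('c, 'k) fq_tensor"
  where "tensor_Cons \<equiv> bilin_ext (\<lambda>h hs. basis (h # hs))"

abbreviation tensor_pair ::
    "('c, 'k::comm_ring_1) fqsym \<Rightarrow> ('c, 'k) fqsym \<Rightarrow> ('c colperm \<times> 'c colperm \<Rightarrow>\<^sub>0 'k)"
  where "tensor_pair \<equiv> bilin_ext (\<lambda>h k. basis (h, k))"

lemma lookup_bilin_ext: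
  assumes "finite A" "supp F \<subseteq> A" "finite B" "supp H \<subseteq> B"
  shows "coef (bilin_ext \<phi> F H) z = (\<Sum>x\<in>A. \<Sum>y\<in>B. coef F x * coef H y * coef (\<phi> x y) z)"
  unfolding bilin_ext_def
  by (simp add: lookup_lin_ext[OF assms(1,2)] lookup_lin_ext[OF assms(3,4)] sum_distrib_left mult.assoc)

lemma sum_coef_delta:
  "(\<Sum>x\<in>supp F. coef F x * (if x = a then c else 0)) = coef F a * (c :: 'k::comm_ring_1)"
  by (simp add: if_distrib sum.delta not_in_keys_iff_lookup_eq_zero cong: if_cong)

lemma lookup_tensor_pair: "coef (tensor_pair A B) (x, y) = coef A x * coef B y"
proof -
  have "coef (tensor_pair A B) (x, y)
      = (\<Sum>h\<in>supp A. coef A h * (if h = x then (\<Sum>k\<in>supp B. coef B k * (if k = y then 1 else 0)) else 0))"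
    by (simp add: lookup_bilin_ext[OF finite_keys order_refl finite_keys order_refl] lookup_basis
        sum_distrib_left mult.assoc cong: if_cong) (auto intro!: sum.cong simp: sum_distrib_left)
  then show ?thesis by (simp add: sum_coef_delta)
qed

section \<open>Standardization of words of biletters\<close>

definition rank :: "nat set \<Rightarrow> nat \<Rightarrow> nat" where
  "rank A x = card {y \<in> A. y \<le> x}"

lemma rank_strict_mono: "finite A \<Longrightarrow> x \<in> A \<Longrightarrow> y \<in> A \<Longrightarrow> x < y \<Longrightarrow> rank A x < rank A y"
proof -
  assume *: "finite A" "x \<in> A" "y \<in> A" "x < y"
  then have "y \<in> {z \<in> A. z \<le> y} - {z \<in> A. z \<le> x}" "{z \<in> A. z \<le> x} \<subseteq> {z \<in> A. z \<le> y}" by auto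
  then show "rank A x < rank A y"
    unfolding rank_def using *(1) by (intro psubset_card_mono) (auto simp del: mem_Collect_eq)
qed

lemma rank_less_iff: "finite A \<Longrightarrow> x \<in> A \<Longrightarrow> y \<in> A \<Longrightarrow> rank A x < rank A y \<longleftrightarrow> x < y"
  by (metis rank_strict_mono linorder_neqE_nat order_less_asym)

lemma inj_on_rank: "finite A \<Longrightarrow> inj_on (rank A) A"
  by (rule inj_onI) (metis rank_less_iff linorder_neqE_nat order_less_irrefl)

lemma rank_image: assumes "finite A" shows "rank A ` A = {1..card A}"
proof (rule card_subset_eq)
  show "rank A ` A \<subseteq> {1..card A}"
  proof (intro subsetI, elim imageE)
    fix k x assume x: "k = rank A x" "x \<in> A"
    then have "{y \<in> A. y \<le> x} \<noteq> {}" by auto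
    then have "rank A x \<noteq> 0" unfolding rank_def using assms by auto
    moreover have "rank A x \<le> card A" unfolding rank_def by (rule card_mono) (use assms in auto)
    ultimately show "k \<in> {1..card A}" using x by auto
  qed
  show "card (rank A ` A) = card {1..card A}"
    using inj_on_rank[OF assms] by (simp add: card_image)
qed simp

lemma rank_atLeastAtMost: "x \<le> n \<Longrightarrow> rank {1..n} x = x"
proof -
  assume "x \<le> n"
  then have "{y \<in> {1..n}. y \<le> x} = {1..x}" by auto
  then show ?thesis by (simp add: rank_def)
qed

text \<open>A strictly increasing \<open>g\<close> carries the elements of \<open>A\<close> up to
  \<open>x\<close> bijectively to those of the image up to \<open>g x\<close>. Hence standardization
  only sees the relative order of letters.\<close>

lemma rank_image_strict_mono_on:
  assumes "strict_mono_on A g" "x \<in> A"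
  shows "rank (g ` A) (g x) = rank A x"
proof -
  have "{y \<in> g ` A. y \<le> g x} = g ` {y \<in> A. y \<le> x}"
  proof -
    have "g y \<le> g x \<longleftrightarrow> y \<le> x" if "y \<in> A" for y
      using strict_mono_onD[OF assms(1) that assms(2)] strict_mono_onD[OF assms(1) assms(2) that]
      by (metis leD leI le_less)
    then show ?thesis by auto
  qed
  moreover have "inj_on g {y \<in> A. y \<le> x}"
    by (rule inj_on_subset[OF strict_mono_on_imp_inj_on[OF assms(1)]]) auto
  ultimately show ?thesis by (simp add: rank_def card_image)
qed

text \<open>The inverse of \<open>rank A\<close> on \<open>{1..card A}\<close>. Ranks start at 1,
  like the letters of a permutation, whereas list positions start at 0.\<close>

definition enum :: "nat set \<Rightarrow> nat \<Rightarrow> nat" where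
  "enum A k = sorted_list_of_set A ! (k - 1)"

lemma enum_mem: "finite A \<Longrightarrow> k \<in> {1..card A} \<Longrightarrow> enum A k \<in> A"
  unfolding enum_def
  by (metis atLeastAtMost_iff diff_Suc_less less_le_trans nth_mem set_sorted_list_of_set
      length_sorted_list_of_set One_nat_def zero_less_one diff_less order_less_le_trans)

lemma enum_strict_mono_on: "finite A \<Longrightarrow> strict_mono_on {1..card A} (enum A)"
  unfolding enum_def
  by (rule strict_mono_onI) (auto intro!: sorted_wrt_nth_less[OF strict_sorted_list_of_set])

lemma enum_image: assumes "finite A" shows "enum A ` {1..card A} = A"
proof (rule card_subset_eq)
  show "card (enum A ` {1..card A}) = card A"
    using strict_mono_on_imp_inj_on[OF enum_strict_mono_on[OF assms]] by (simp add: card_image)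
qed (use assms enum_mem in auto)

text \<open>\<open>enum A\<close> is a strictly increasing map of \<open>{1..card A}\<close> onto
  \<open>A\<close>, so it preserves ranks, and the rank of \<open>k\<close> in
  \<open>{1..card A}\<close> is \<open>k\<close>.\<close>

lemma rank_enum:
  assumes "finite A" "k \<in> {1..card A}"
  shows "rank A (enum A k) = k"
  using rank_image_strict_mono_on[OF enum_strict_mono_on[OF assms(1)] assms(2)]
    rank_atLeastAtMost[of k "card A"] assms
  by (simp only: enum_image[OF assms(1)]) auto

lemma enum_rank:
  assumes "finite A" "x \<in> A"
  shows "enum A (rank A x) = x"
proof -
  obtain k where k: "k \<in> {1..card A}" "x = enum A k"
    using enum_image[OF assms(1)] assms(2) by (metis imageE)
  then show ?thesis by (simp add: rank_enum[OF assms(1)])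
qed

section \<open>Standardization of uncolored words and inversions\<close>

lemma nth_less_iff_inversions:
  assumes "distinct w" "i < length w" "j < length w"
  shows "w ! j < w ! i \<longleftrightarrow> (if i < j then (i, j) \<in> inversions w else j \<noteq> i \<and> (j, i) \<notin> inversions w)"
  using assms nth_eq_iff_index_eq[OF assms] by (auto simp: inversions_def)

text \<open>Turns a rank, which depends on the values of the letters, into a count of positions,
  which the inversions alone determine.\<close>

lemma rank_nth:
  assumes "distinct w" "i < length w"
  shows "rank (set w) (w ! i) = card {j. j < length w \<and> (j = i \<or> w ! j < w ! i)}"
proof -
  have "{y \<in> set w. y \<le> w ! i} = (!) w ` {j. j < length w \<and> (j = i \<or> w ! j < w ! i)}"
    using assms by (force simp: in_set_conv_nth image_iff le_less nth_eq_iff_index_eq)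
  moreover have "inj_on ((!) w) {j. j < length w \<and> (j = i \<or> w ! j < w ! i)}"
    using assms by (auto simp: inj_on_def nth_eq_iff_index_eq)
  ultimately show ?thesis by (simp add: rank_def card_image)
qed

lemma map_rank_cong_inversions:
  assumes "distinct v" "distinct w" "length v = length w" "inversions v = inversions w"
  shows "map (rank (set v)) v = map (rank (set w)) w"
proof (rule nth_equalityI)
  fix i assume "i < length (map (rank (set v)) v)"
  then show "map (rank (set v)) v ! i = map (rank (set w)) w ! i"
    using assms by (simp add: rank_nth) (intro arg_cong[where f = card] Collect_cong conj_cong refl,
        simp add: nth_less_iff_inversions)
qed (simp add: assms)

lemma map_rank_perm:
  assumes "s \<in> permutations_of_set {1..n}"
  shows "map (rank (set s)) s = s"
  using assms by (auto simp: permutations_of_set_def rank_atLeastAtMost intro!: map_idI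
      simp del: One_nat_def)

lemma map_rank_in_permutations:
  assumes "distinct w"
  shows "map (rank (set w)) w \<in> permutations_of_set {1..length w}"
  using assms rank_image[of "set w"] inj_on_rank[of "set w"]
  by (auto simp: permutations_of_set_def distinct_map distinct_card simp del: One_nat_def)

lemma inversions_map_rank: "inversions (map (rank (set w)) w) = inversions w"
  by (auto simp: inversions_def rank_less_iff)

text \<open>Resolves the definite description in \<open>std\<close>: replacing letters by ranks
  keeps the inversions, two words with the same inversions have the same ranks, and a permutation is
  its own word of ranks.\<close>

lemma std_eq_map_rank:
  assumes "distinct w"
  shows "std w = map (rank (set w)) w"
  unfolding std_def
proof (rule the_equality)
  show "map (rank (set w)) w \<in> permutations_of_set {1..length w}
      \<and> inversions (map (rank (set w)) w) = inversions w"
    using map_rank_in_permutations[OF assms] inversions_map_rank by blast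
next
  fix s assume s: "s \<in> permutations_of_set {1..length w} \<and> inversions s = inversions w"
  then have "distinct s" "length s = length w"
    using length_finite_permutations_of_set by (force simp: permutations_of_set_def)+
  then show "s = map (rank (set w)) w"
    using map_rank_cong_inversions[of s w] assms s map_rank_perm by metis
qed

text \<open>Words whose letters are distinct but arbitrary are standardized letterwise, which makes \<open>Std\<close>
  commute with taking factors and subwords.\<close>

abbreviation letters :: "(nat \<times> 'c) list \<Rightarrow> nat set" where
  "letters w \<equiv> fst ` set w"

abbreviation distinct_letters :: "(nat \<times> 'c) list \<Rightarrow> bool" where
  "distinct_letters w \<equiv> distinct (map fst w)"

definition Std :: "(nat \<times> 'c) list \<Rightarrow> 'c colperm" where
  "Std w = Abs_colperm (map (apfst (rank (letters w))) w)"

lemma map_fst_apfst: "map fst (map (apfst g) w) = map g (map fst w)"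
  by auto

lemma biword_Std:
  assumes "distinct_letters w"
  shows "biword (Std w) = map (apfst (rank (letters w))) w"
  unfolding Std_def
proof (rule Abs_colperm_inverse)
  show "map (apfst (rank (letters w))) w \<in> {w. map fst w \<in> permutations_of_set {1..length w}}"
    using map_rank_in_permutations[OF assms] by (simp add: map_fst_apfst del: map_map list.map_comp)
qed

lemma biword_perm: "map fst (biword h) \<in> permutations_of_set {1..deg h}"
  using biword[of h] by (simp add: deg_def)

lemma distinct_letters_biword [simp]: "distinct_letters (biword h)"
  and letters_biword [simp]: "letters (biword h) = {1..deg h}"
  using biword_perm[of h] by (auto simp: permutations_of_set_def)

lemma length_biword [simp]: "length (biword h) = deg h"
  by (simp add: deg_def)

lemma biword_letter_bounds: "(t, c) \<in> set (biword h) \<Longrightarrow> 1 \<le> t \<and> t \<le> deg h"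
  using letters_biword[of h] by (metis atLeastAtMost_iff fst_conv image_eqI)

lemma Std_biword [simp]: "Std (biword h) = h"
proof -
  have "map (apfst (rank {1..deg h})) (biword h) = biword h"
    by (rule map_idI) (auto simp: rank_atLeastAtMost dest: biword_letter_bounds simp del: One_nat_def)
  then show ?thesis by (simp add: Std_def biword_inverse del: One_nat_def)
qed

lemma colperm_eqI: "perm h = perm k \<Longrightarrow> colors h = colors k \<Longrightarrow> h = k"
  unfolding perm_def colors_def by (metis biword_inject zip_map_fst_snd)

lemma deg_Std [simp]: "distinct_letters w \<Longrightarrow> deg (Std w) = length w"
  by (simp add: deg_def biword_Std)

lemma perm_Std: "distinct_letters w \<Longrightarrow> perm (Std w) = std (map fst w)"
  by (simp add: perm_def biword_Std std_eq_map_rank)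

lemma colors_Std: "distinct_letters w \<Longrightarrow> colors (Std w) = map snd w"
  by (simp add: colors_def biword_Std)

lemma letters_map_apfst: "letters (map (apfst g) w) = g ` letters w"
  by (simp add: image_image)

lemma Std_map_strict_mono:
  assumes "strict_mono_on (letters w) g"
  shows "Std (map (apfst g) w) = Std w"
proof -
  have "map (apfst (rank (letters (map (apfst g) w)))) (map (apfst g) w)
      = map (apfst (rank (letters w))) w"
    unfolding letters_map_apfst
    by (auto intro!: rank_image_strict_mono_on[OF assms] simp: rev_image_eqI)
  then show ?thesis by (simp only: Std_def)
qed

lemma strict_mono_on_rank: "finite A \<Longrightarrow> B \<subseteq> A \<Longrightarrow> strict_mono_on B (rank A)"
  by (auto intro!: strict_mono_onI rank_strict_mono)

text \<open>\<open>rank (letters w)\<close> is strictly increasing on every subset of the letters,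
  so standardizing the whole word first does not affect the standardization of a prefix.\<close>

lemma Std_take_Std:
  assumes "distinct_letters w"
  shows "Std (take p (biword (Std w))) = Std (take p w)"
  unfolding biword_Std[OF assms] take_map
  by (intro Std_map_strict_mono strict_mono_on_rank) (auto dest: in_set_takeD)

lemma Std_drop_Std:
  assumes "distinct_letters w"
  shows "Std (drop p (biword (Std w))) = Std (drop p w)"
  unfolding biword_Std[OF assms] drop_map
  by (intro Std_map_strict_mono strict_mono_on_rank) (auto dest: in_set_dropD)

text \<open>Together with \<open>Std_relabel\<close>, this identifies the words that use each letter
  of a fixed \<open>n\<close>-element set once with the colored permutations of degree
  \<open>n\<close>.\<close>

lemma unstandardize:
  assumes "distinct_letters w"
  shows "map (apfst (enum (letters w))) (biword (Std w)) = w"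
  unfolding biword_Std[OF assms] by (auto intro!: map_idI enum_rank rev_image_eqI)

lemma Std_relabel:
  assumes "finite A" "card A = deg h"
  shows "Std (map (apfst (enum A)) (biword h)) = h"
    and "letters (map (apfst (enum A)) (biword h)) = A"
    and "distinct_letters (map (apfst (enum A)) (biword h))"
proof -
  have *: "strict_mono_on (letters (biword h)) (enum A)"
    using enum_strict_mono_on[OF assms(1)] assms(2) by simp
  show "Std (map (apfst (enum A)) (biword h)) = h"
    using Std_map_strict_mono[OF *] by simp
  show "letters (map (apfst (enum A)) (biword h)) = A"
    unfolding letters_map_apfst using enum_image[OF assms(1)] assms(2) by simp
  show "distinct_letters (map (apfst (enum A)) (biword h))"
    unfolding map_fst_apfst
    by (subst distinct_map) (use strict_mono_on_imp_inj_on[OF *] in simp)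
qed

lemma distinct_letters_take: "distinct_letters w \<Longrightarrow> distinct_letters (take p w)"
  and distinct_letters_drop: "distinct_letters w \<Longrightarrow> distinct_letters (drop p w)"
  by (simp_all add: take_map[symmetric] drop_map[symmetric])

lemma biword_Std_permutation:
  assumes "distinct_letters w" "letters w = {1..n}"
  shows "biword (Std w) = w"
proof -
  have "biword (Std w) = map (apfst (rank {1..n})) w"
    using biword_Std[OF assms(1)] assms(2) by simp
  also have "\<dots> = w"
  proof (rule map_idI)
    fix b assume "b \<in> set w"
    then have "fst b \<in> {1..n}" using assms(2) by blast
    then show "apfst (rank {1..n}) b = b"
      by (cases b) (simp add: rank_atLeastAtMost del: One_nat_def)
  qed
  finally show ?thesis .
qed

section \<open>Elements as functions on words\<close>

abbreviation wcoef :: "('c, 'k::comm_ring_1) fqsym \<Rightarrow> (nat \<times> 'c) list \<Rightarrow> 'k" where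
  "wcoef F w \<equiv> coef F (Std w)"

text \<open>Every basis index \<open>h\<close> is \<open>Std (biword h)\<close>, so no coefficient
  is missed by testing on words.\<close>

lemma fqsym_eqI:
  assumes "\<And>w. distinct_letters w \<Longrightarrow> wcoef F w = wcoef H w"
  shows "F = H"
  by (rule poly_mapping_eqI) (use assms[of "biword _"] in simp)

lemma coef_sum_G: "finite X \<Longrightarrow> coef (\<Sum>h\<in>X. G h) g = (if g \<in> X then 1 else 0)"
  by (simp add: lookup_sum G_def lookup_basis sum.delta)

abbreviation conv_colperms :: "'c colperm \<Rightarrow> 'c colperm \<Rightarrow> 'c colperm set" where
  "conv_colperms h' h'' \<equiv>
     {h. perm h \<in> convolution (perm h') (perm h'') \<and> colors h = colors h' @ colors h''}"

text \<open>A sum over an infinite set would be 0, so finiteness gives the sum in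
  \<open>fq_mult\<close> its meaning.\<close>

lemma finite_conv_colperms: "finite (conv_colperms h' h'')"
proof (rule finite_imageD[where f = "\<lambda>h. (perm h, colors h)"])
  show "finite ((\<lambda>h. (perm h, colors h)) ` conv_colperms h' h'')"
    by (rule finite_subset[where B = "permutations_of_set {1..length (perm h') + length (perm h'')}
          \<times> {colors h' @ colors h''}"]) (auto simp: convolution_def)
  show "inj_on (\<lambda>h. (perm h, colors h)) (conv_colperms h' h'')"
    by (rule inj_onI) (auto intro: colperm_eqI)
qed

lemma perm_length [simp]: "length (perm h) = deg h" "length (colors h) = deg h"
  by (simp_all add: perm_def colors_def)

lemma perm_in_permutations: "perm h \<in> permutations_of_set {1..deg h}"
  using biword_perm by (simp add: perm_def)

text \<open>Standardizing commutes with cutting, so membership in the convolution can be tested on a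
  prefix and a suffix of \<open>w\<close> itself.\<close>

lemma in_conv_colperms_iff:
  assumes "distinct_letters w"
  shows "Std w \<in> conv_colperms h' h'' \<longleftrightarrow>
    length w = deg h' + deg h'' \<and> Std (take (deg h') w) = h' \<and> Std (drop (deg h') w) = h''"
    (is "?l \<longleftrightarrow> ?r")
proof -
  define p where "p = deg h'"
  have tk: "std (take p (perm (Std w))) = perm (Std (take p w))"
    "std (drop p (perm (Std w))) = perm (Std (drop p w))"
    by (simp_all add: perm_def take_map drop_map Std_take_Std[OF assms, symmetric]
        Std_drop_Std[OF assms, symmetric] perm_Std[unfolded perm_def]
        distinct_letters_take distinct_letters_drop)
  have cl: "colors (Std w) = colors (Std (take p w)) @ colors (Std (drop p w))"
    by (simp add: colors_Std assms distinct_letters_take distinct_letters_drop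
        flip: map_append)
  have dg: "deg (Std (take p w)) = min (length w) p"
    by (simp add: distinct_letters_take assms)
  show ?thesis
  proof
    assume l: ?l
    then have "perm (Std w) \<in> permutations_of_set {1..deg h' + deg h''}"
      by (simp add: convolution_def)
    then have len: "length w = deg h' + deg h''"
      using length_finite_permutations_of_set[of "perm (Std w)"] assms by simp
    moreover have "perm (Std (take p w)) = perm h'" "perm (Std (drop p w)) = perm h''"
      using l tk by (auto simp: convolution_def p_def)
    moreover have "colors (Std (take p w)) = colors h' \<and> colors (Std (drop p w)) = colors h''"
      using l cl len dg by (simp add: p_def)
    ultimately show ?r
      using colperm_eqI unfolding p_def by blast
  next
    assume r: ?r
    then show ?l
      using perm_in_permutations[of "Std w"] tk cl assms
      by (auto simp: convolution_def p_def)
  qed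
qed

lemma wcoef_fq_mult:
  assumes "distinct_letters w"
  shows "wcoef (fq_mult F H) w = (\<Sum>p\<le>length w. wcoef F (take p w) * wcoef H (drop p w))"
proof -
  have "coef (\<Sum>h\<in>conv_colperms x y. G h :: ('a, 'b) fqsym) (Std w)
      = (\<Sum>p\<le>length w. (if x = Std (take p w) then (if y = Std (drop p w) then 1 else 0) else 0))"
    (is "_ = sum ?f _") for x y
  proof -
    \<comment> \<open>The standardization of a prefix has the length of the prefix as its degree, so
      for a given \<open>x\<close> only the cut at \<open>deg x\<close> can contribute.\<close>
    have "?f p = 0" if "p \<noteq> deg x" "p \<le> length w" for p
      using that assms distinct_letters_take[OF assms, of p] by (auto simp: min_absorb2)
    then have "sum ?f {..length w} = (if deg x \<le> length w then ?f (deg x) else 0)"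
      by (subst sum.mono_neutral_right[where S = "{..length w} \<inter> {deg x}"]) auto
    also have "\<dots> = coef (\<Sum>h\<in>conv_colperms x y. G h :: ('a, 'b) fqsym) (Std w)"
      unfolding coef_sum_G[OF finite_conv_colperms] in_conv_colperms_iff[OF assms]
      using distinct_letters_drop[OF assms, of "deg x"] by auto
    finally show ?thesis by simp
  qed
  then have "wcoef (fq_mult F H) w = (\<Sum>x\<in>supp F. \<Sum>y\<in>supp H. coef F x * coef H y *
      (\<Sum>p\<le>length w. (if x = Std (take p w) then (if y = Std (drop p w) then 1 else 0) else 0)))"
    unfolding fq_mult_def lookup_bilin_ext[OF finite_keys order_refl finite_keys order_refl]
    by simp
  also have "\<dots> = (\<Sum>p\<le>length w. \<Sum>x\<in>supp F. coef F x * (if x = Std (take p w) then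
      (\<Sum>y\<in>supp H. coef H y * (if y = Std (drop p w) then 1 else 0)) else 0))"
    unfolding sum_distrib_left
    by (subst sum.swap[of _ "{..length w}" "supp H"], subst sum.swap[of _ "{..length w}" "supp F"])
      (intro sum.cong refl, auto simp: sum_distrib_left mult.assoc)
  finally show ?thesis by (simp add: sum_coef_delta)
qed

lemma Std_eq_id_Nil_iff: "distinct_letters w \<Longrightarrow> Std w = id_colored [] \<longleftrightarrow> w = []"
proof -
  assume w: "distinct_letters w"
  have b: "biword (id_colored []) = []" by transfer simp
  have "w = []" if "Std w = id_colored []"
    using that biword_Std[OF w] b by (metis map_is_Nil_conv)
  moreover have "Std [] = id_colored ([] :: 'a list)"
    using b Std_biword by metis
  ultimately show ?thesis by auto
qed

lemma wcoef_fq_one: "distinct_letters w \<Longrightarrow> wcoef fq_one w = (if w = [] then 1 else 0)"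
  using Std_eq_id_Nil_iff[of w] by (auto simp: fq_one_def G_def lookup_basis)

lemma fq_mult_one_right [simp]: "fq_mult F fq_one = F"
proof (rule fqsym_eqI)
  fix w :: "(nat \<times> 'a) list" assume w: "distinct_letters w"
  have "wcoef (fq_mult F fq_one) w
      = (\<Sum>p\<le>length w. if p = length w then wcoef F w else 0)"
    unfolding wcoef_fq_mult[OF w]
    by (intro sum.cong refl) (auto simp: wcoef_fq_one distinct_letters_drop[OF w])
  then show "wcoef (fq_mult F fq_one) w = wcoef F w" by simp
qed

lemma fq_mult_assoc: "fq_mult (fq_mult F H) K = fq_mult F (fq_mult H K)"
proof (rule fqsym_eqI)
  fix w :: "(nat \<times> 'a) list" assume w: "distinct_letters w"
  let ?n = "length w"
  have "wcoef (fq_mult (fq_mult F H) K) w = (\<Sum>p\<le>?n. \<Sum>q\<le>p.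
      wcoef F (take q w) * wcoef H (drop q (take p w)) * wcoef K (drop p w))"
    by (simp add: wcoef_fq_mult w distinct_letters_take sum_distrib_right min_absorb2 min_absorb1)
  also have "\<dots> = (\<Sum>(p, q)\<in>Sigma {..?n} (\<lambda>p. {..p}).
      wcoef F (take q w) * wcoef H (drop q (take p w)) * wcoef K (drop p w))"
    by (simp add: sum.Sigma)
  \<comment> \<open>Both sides sum over two cuts \<open>q \<le> p\<close> of \<open>w\<close>; the
    second cut is now measured from the first one, \<open>r = p - q\<close>.\<close>
  also have "\<dots> = (\<Sum>(q, r)\<in>Sigma {..?n} (\<lambda>q. {..?n - q}).
      wcoef F (take q w) * (wcoef H (take r (drop q w)) * wcoef K (drop r (drop q w))))"
    by (rule sum.reindex_bij_witness[where i = "\<lambda>(q, r). (q + r, q)" and j = "\<lambda>(p, q). (q, p - q)"])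
      (auto simp: drop_take mult.assoc)
  also have "\<dots> = wcoef (fq_mult F (fq_mult H K)) w"
    by (simp add: wcoef_fq_mult w distinct_letters_drop sum_distrib_left sum.Sigma)
  finally show "wcoef (fq_mult (fq_mult F H) K) w = wcoef (fq_mult F (fq_mult H K)) w" .
qed

section \<open>Shuffles and the coproduct\<close>

lemma append_in_shuffles:
  "a \<in> shuffles xs ys \<Longrightarrow> b \<in> shuffles xs' ys' \<Longrightarrow> a @ b \<in> shuffles (xs @ xs') (ys @ ys')"
proof (induction xs ys arbitrary: a rule: shuffles.induct)
  case (3 x xs y ys)
  then show ?case by (auto simp: Cons_in_shuffles_iff)
next
  case (1 ys)
  then have "a = ys" by simp
  then show ?case using 1(2)
    by (induction ys arbitrary: a) (auto intro: Cons_in_shuffles_rightI)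
next
  case (2 xs)
  then have "a = xs" by simp
  then show ?case using 2(2)
    by (induction xs arbitrary: a) (auto intro: Cons_in_shuffles_leftI)
qed

text \<open>Filtering a shuffle gives a shuffle of the filtered words, one of which is empty. Words
  without common letters can thus be read off from any of their shuffles.\<close>

lemma filter_shuffle:
  assumes "w \<in> shuffles xs ys" "\<And>x. x \<in> set xs \<Longrightarrow> P x" "\<And>y. y \<in> set ys \<Longrightarrow> \<not> P y"
  shows "filter P w = xs" "filter (\<lambda>x. \<not> P x) w = ys"
proof -
  have "filter P w \<in> shuffles (filter P xs) (filter P ys)"
    "filter (\<lambda>x. \<not> P x) w \<in> shuffles (filter (\<lambda>x. \<not> P x) xs) (filter (\<lambda>x. \<not> P x) ys)"
    using assms(1) filter_shuffles by blast+
  moreover have "filter P xs = xs" "filter P ys = []" "filter (\<lambda>x. \<not> P x) xs = []"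
    "filter (\<lambda>x. \<not> P x) ys = ys"
    using assms(2,3) by (auto simp: filter_id_conv filter_empty_conv)
  ultimately show "filter P w = xs" "filter (\<lambda>x. \<not> P x) w = ys" by simp_all
qed

text \<open>Cutting a shuffle cuts both words, say after \<open>i\<close> and \<open>j\<close>
  letters, and leaves a shuffle of the prefixes and one of the suffixes. Disjointness makes this a
  bijection, since \<open>i\<close> and \<open>j\<close> are the numbers of letters from
  \<open>xs\<close> and \<open>ys\<close> in the left part. It expresses the compatibility of
  product and coproduct.\<close>

lemma sum_shuffles_deconcatenate:
  assumes "set xs \<inter> set ys = {}"
  shows "(\<Sum>w\<in>shuffles xs ys. \<Sum>p\<le>length w. g (take p w) (drop p w)) =
    (\<Sum>i\<le>length xs. \<Sum>j\<le>length ys. \<Sum>a\<in>shuffles (take i xs) (take j ys).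
      \<Sum>b\<in>shuffles (drop i xs) (drop j ys). (g a b :: 'k::comm_monoid_add))"
proof -
  let ?P = "\<lambda>x. x \<in> set xs"
  have d: "\<not> ?P y" if "y \<in> set ys" for y using assms that by auto
  let ?A = "Sigma (shuffles xs ys) (\<lambda>w. {..length w})"
  let ?B = "Sigma {..length xs} (\<lambda>i. Sigma {..length ys} (\<lambda>j.
      shuffles (take i xs) (take j ys) \<times> shuffles (drop i xs) (drop j ys)))"
  have "(\<Sum>(w, p)\<in>?A. g (take p w) (drop p w)) = (\<Sum>(i, j, a, b)\<in>?B. g a b)"
  proof (rule sum.reindex_bij_witness[where
        i = "\<lambda>(i, j, a, b). (a @ b, length a)" and
        j = "\<lambda>(w, p). (length (filter ?P (take p w)), length (filter (\<lambda>x. \<not> ?P x) (take p w)),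
          take p w, drop p w)"], goal_cases)
    case (1 x)
    then show ?case by auto
  next
    case (2 x)
    then obtain w p where x: "x = (w, p)" "w \<in> shuffles xs ys" "p \<le> length w" by auto
    define a b where "a = take p w" and "b = drop p w"
    have w: "w = a @ b" by (simp add: a_def b_def)
    have "filter ?P a @ filter ?P b = xs"
      "filter (\<lambda>x. \<not> ?P x) a @ filter (\<lambda>x. \<not> ?P x) b = ys"
      using filter_shuffle[OF x(2), of ?P] d by (auto simp: w)
    then have "take (length (filter ?P a)) xs = filter ?P a" "drop (length (filter ?P a)) xs = filter ?P b"
      "take (length (filter (\<lambda>x. \<not> ?P x) a)) ys = filter (\<lambda>x. \<not> ?P x) a"
      "drop (length (filter (\<lambda>x. \<not> ?P x) a)) ys = filter (\<lambda>x. \<not> ?P x) b"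
      "length (filter ?P a) \<le> length xs" "length (filter (\<lambda>x. \<not> ?P x) a) \<le> length ys"
      by (metis append_eq_conv_conj length_append le_add1)+
    then show ?case
      using partition_in_shuffles[of a ?P] partition_in_shuffles[of b ?P]
      by (simp add: x a_def[symmetric] b_def[symmetric])
  next
    case (3 y)
    then obtain i j a b where y: "y = (i, j, a, b)" "i \<le> length xs" "j \<le> length ys"
      "a \<in> shuffles (take i xs) (take j ys)" "b \<in> shuffles (drop i xs) (drop j ys)" by auto
    have "filter ?P a = take i xs" "filter (\<lambda>x. \<not> ?P x) a = take j ys"
      using filter_shuffle[OF y(4), of ?P] d by (auto dest: in_set_takeD)
    then show ?case using y by simp
  next
    case (4 y)
    then obtain i j a b where y: "y = (i, j, a, b)"
      "a \<in> shuffles (take i xs) (take j ys)" "b \<in> shuffles (drop i xs) (drop j ys)" by auto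
    then show ?case
      using append_in_shuffles[OF y(2,3)] by simp
  next
    case (5 x)
    then show ?case by auto
  qed
  then show ?thesis by (simp add: sum.Sigma sum.cartesian_product)
qed

section \<open>Coproduct coefficients as sums over shuffles\<close>

lemma distinct_letters_shuffles:
  assumes "w \<in> shuffles xs ys"
  shows "distinct_letters w \<longleftrightarrow> distinct_letters (xs @ ys)"
proof -
  have "mset (map fst w) = mset (map fst (xs @ ys))"
    using mset_shuffles[OF assms] by simp
  then show ?thesis by (metis mset_eq_imp_distinct_iff)
qed

text \<open>When \<open>w\<close> is a biword shifted by the degree of the biword \<open>v\<close>,
  this is a coefficient of the coproduct of \<open>F\<close> (see \<open>coef_coproduct\<close>).
  Other pairs are allowed because unshuffling an arbitrary word leads to them.\<close>

definition shuffle_sum ::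
    "('c, 'k::comm_ring_1) fqsym \<Rightarrow> (nat \<times> 'c) list \<Rightarrow> (nat \<times> 'c) list \<Rightarrow> 'k" where
  "shuffle_sum F v w = (\<Sum>x\<in>shuffles v w. wcoef F x)"

lemma shuffle_sum_fq_mult:
  assumes "distinct_letters (v @ w)"
  shows "shuffle_sum (fq_mult F H) v w = (\<Sum>i\<le>length v. \<Sum>j\<le>length w.
      shuffle_sum F (take i v) (take j w) * shuffle_sum H (drop i v) (drop j w))"
proof -
  have "set v \<inter> set w = {}" using assms by force
  from sum_shuffles_deconcatenate[OF this, where g = "\<lambda>a b. wcoef F a * wcoef H b"]
  show ?thesis
    using assms unfolding shuffle_sum_def
    by (simp add: wcoef_fq_mult distinct_letters_shuffles sum_product)
qed

lemma letters_shift: "letters (shift p (biword h)) = {p + 1..p + deg h}"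
  and Std_shift: "Std (shift p (biword h)) = h"
  and length_shift [simp]: "length (shift p v) = length v"
proof -
  have *: "shift p v = map (apfst (\<lambda>t. t + p)) v" for v :: "(nat \<times> 'a) list"
    by (auto simp: shift_def)
  show "letters (shift p (biword h)) = {p + 1..p + deg h}"
    unfolding * letters_map_apfst letters_biword by (simp add: add.commute)
  have "Std (shift p (biword h)) = Std (biword h)"
    unfolding * by (rule Std_map_strict_mono) (auto intro: strict_mono_onI)
  then show "Std (shift p (biword h)) = h" by simp
qed (simp add: shift_def)

lemma distinct_letters_append_shift: "distinct_letters (biword x @ shift (deg x) (biword y))"
proof -
  have "map fst (shift p v) = map (\<lambda>t. t + p) (map fst v)" for p and v :: "(nat \<times> 'a) list"
    by (auto simp: shift_def)
  then have "distinct_letters (shift (deg x) (biword y))"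
    by (simp only: distinct_map[of "\<lambda>t. t + deg x" "map fst (biword y)"]) simp
  then show ?thesis
    using letters_shift[of "deg x" y] by auto
qed

text \<open>The shift makes the letters of the two words fill \<open>{1..deg x + deg y}\<close>
  exactly, so standardization changes nothing.\<close>

lemma shuffle_shift_is_biword:
  assumes "w \<in> shuffles (biword x) (shift (deg x) (biword y))"
  shows "biword (Std w) = w"
proof -
  have l: "letters w = {1..deg x + deg y}"
    using set_shuffles[OF assms] letters_shift[of "deg x" y] letters_biword[of x]
    by (auto simp: image_Un simp del: letters_biword)
  have "distinct_letters w"
    using distinct_letters_shuffles[OF assms] distinct_letters_append_shift by blast
  then show ?thesis using l by (rule biword_Std_permutation)
qed

abbreviation uncoproduct :: "'c colperm \<Rightarrow> ('c colperm \<times> 'c colperm) set" where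
  "uncoproduct h \<equiv> {(h', h''). biword h \<in> shuffles (biword h') (shift (deg h') (biword h''))}"

text \<open>After the shift both factors only use biletters of \<open>h\<close>, which leaves
  finitely many pairs of words, and standardization recovers the factors from these words.\<close>

lemma finite_uncoproduct: "finite (uncoproduct h)"
proof (rule finite_imageD[where f = "\<lambda>(h', h''). (biword h', shift (deg h') (biword h''))"])
  let ?W = "{w. set w \<subseteq> set (biword h) \<and> length w \<le> deg h}"
  have "(\<lambda>(h', h''). (biword h', shift (deg h') (biword h''))) ` uncoproduct h \<subseteq> ?W \<times> ?W"
    by (auto dest: set_shuffles length_shuffles)
  then show "finite ((\<lambda>(h', h''). (biword h', shift (deg h') (biword h''))) ` uncoproduct h)"
    by (rule finite_subset) (simp add: finite_lists_length_le)
  show "inj_on (\<lambda>(h', h''). (biword h', shift (deg h') (biword h''))) (uncoproduct h)"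
    by (rule inj_onI) (auto simp: biword_inject intro: Std_shift[symmetric, THEN trans] dest: arg_cong[of _ _ Std] simp: Std_shift)
qed

lemma coef_coproduct:
  fixes H :: "('c, 'k::comm_ring_1) fqsym"
  shows "coef (coproduct H) (x, y) = shuffle_sum H (biword x) (shift (deg x) (biword y))"
proof -
  let ?Sh = "shuffles (biword x) (shift (deg x) (biword y))"
  have "coef (\<Sum>(h', h'')\<in>uncoproduct h. basis (h', h'') :: _ \<Rightarrow>\<^sub>0 'k) (x, y)
      = (if biword h \<in> ?Sh then 1 else 0)" for h
  proof -
    have "coef (\<Sum>(h', h'')\<in>uncoproduct h. basis (h', h'') :: _ \<Rightarrow>\<^sub>0 'k) (x, y)
      = (\<Sum>z\<in>uncoproduct h. if z = (x, y) then 1 else 0)"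
      by (auto simp: lookup_sum lookup_basis intro!: sum.cong)
    then show ?thesis using finite_uncoproduct[of h] by (simp add: sum.delta)
  qed
  then have "coef (coproduct H) (x, y) = (\<Sum>h\<in>supp H. if biword h \<in> ?Sh then coef H h else 0)"
    unfolding coproduct_def lookup_lin_ext[OF finite_keys order_refl]
    by (auto intro!: sum.cong)
  also have "\<dots> = (\<Sum>h\<in>{h \<in> supp H. biword h \<in> ?Sh}. coef H h)"
    by (rule sum.inter_filter[symmetric]) simp
  also have "\<dots> = (\<Sum>w\<in>?Sh. wcoef H w)"
  \<comment> \<open>The shuffles whose standardization is outside the support are collected in
    \<open>T'\<close> and contribute 0; on the others \<open>Std\<close> and \<open>biword\<close>
    are inverse to each other.\<close>
  proof (rule sum.reindex_bij_witness_not_neutral[where i = Std and j = biword and S' = "{}"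
        and T' = "{w \<in> ?Sh. Std w \<notin> supp H}"])
    show "finite {w \<in> ?Sh. Std w \<notin> supp H}" by (rule finite_subset[of _ ?Sh]) auto
  qed (auto simp: shuffle_shift_is_biword in_keys_iff)
  finally show ?thesis by (simp add: shuffle_sum_def)
qed

section \<open>Splitting over a product of two factors\<close>

text \<open>\<open>*'\<close> with \<open>G h\<close> on the left is the action of \<open>h\<close> on words by place permutation and
  multiplication of colors; it is therefore defined on words with arbitrary letters.\<close>

definition act :: "('c \<Rightarrow> 'c \<Rightarrow> 'c) \<Rightarrow> (nat \<times> 'c) list \<Rightarrow> (nat \<times> 'c) list \<Rightarrow> (nat \<times> 'c) list" where
  "act f w b = map (\<lambda>(t, d). (fst (w ! (t - 1)), f (snd (w ! (t - 1))) d)) b"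

lemma biword_wreath_mult:
  "deg g = deg h \<Longrightarrow> biword (wreath_mult f g h) = act f (biword g) (biword h)"
  by (simp add: wreath_mult.rep_eq act_def)

lemma length_act [simp]: "length (act f w b) = length b"
  by (simp add: act_def)

lemma act_append: "act f w (b @ b') = act f w b @ act f w b'"
  by (simp add: act_def)

text \<open>The bound on the letters of \<open>b\<close> keeps every access
  \<open>w ! (t - 1)\<close> inside the list, where \<open>map\<close> and indexing commute.\<close>

lemma act_map_apfst:
  assumes "letters b \<subseteq> {1..length w}"
  shows "act f (map (apfst g) w) b = map (apfst g) (act f w b)"
proof -
  have "t - 1 < length w" if "(t, c) \<in> set b" for t c
    using assms that by force
  then show ?thesis by (auto simp: act_def)
qed

lemma letters_act:
  assumes "letters b = {1..length w}"
  shows "letters (act f w b) = letters w"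
proof -
  have "letters (act f w b) = (\<lambda>t. fst (w ! (t - 1))) ` letters b"
    by (simp add: act_def image_image case_prod_beta)
  also have "\<dots> = (\<lambda>i. fst (w ! i)) ` {..<length w}"
    unfolding assms by (force simp: image_iff Bex_def intro: exI[of _ "Suc _"])
  also have "\<dots> = letters w"
    by (force simp: in_set_conv_nth)
  finally show ?thesis .
qed

section \<open>Multiplication by a single \<open>G h\<close> on words with arbitrary letters\<close>

definition color_set :: "('c, 'k::comm_ring_1) fqsym \<Rightarrow> 'c set" where
  "color_set F = (\<Union>x\<in>supp F. snd ` set (biword x))"

lemma finite_color_set: "finite (color_set F)"
  by (simp add: color_set_def)

text \<open>The set \<open>K\<close> only keeps \<open>rewords K w\<close> finite when there are infinitely many colors.\<close>

definition rewords :: "'c set \<Rightarrow> (nat \<times> 'c) list \<Rightarrow> (nat \<times> 'c) list set" where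
  "rewords K w = {y. distinct_letters y \<and> letters y = letters w \<and> snd ` set y \<subseteq> K}"

lemma card_letters: "distinct_letters w \<Longrightarrow> card (letters w) = length w"
  by (metis distinct_card length_map list.set_map)

lemma length_rewords:
  assumes "distinct_letters w" "y \<in> rewords K w"
  shows "length y = length w"
  using assms card_letters[of y] card_letters[of w] by (simp add: rewords_def)

lemma finite_rewords:
  assumes "distinct_letters w" "finite K"
  shows "finite (rewords K w)"
proof (rule finite_subset)
  show "rewords K w \<subseteq> {y. set y \<subseteq> letters w \<times> K \<and> length y \<le> length w}"
  proof
    fix y assume y: "y \<in> rewords K w"
    then have "set y \<subseteq> letters w \<times> K" unfolding rewords_def by (force simp: image_subset_iff)
    then show "y \<in> {y. set y \<subseteq> letters w \<times> K \<and> length y \<le> length w}"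
      using length_rewords[OF assms(1) y] by simp
  qed
  show "finite {y. set y \<subseteq> letters w \<times> K \<and> length y \<le> length w}"
    by (rule finite_lists_length_le) (use assms in auto)
qed

text \<open>The two equations arise from each other by renaming \<open>1, ..., n\<close>
  increasingly to the letters of \<open>w\<close>, which commutes with \<open>act\<close> and is
  undone by \<open>Std\<close>.\<close>

lemma act_relabel_iff:
  assumes "distinct_letters w" "length w = deg h" "deg x = deg h"
  shows "act f (map (apfst (enum (letters w))) (biword x)) (biword h) = w
    \<longleftrightarrow> wreath_mult f x h = Std w"
proof -
  have deg: "deg (wreath_mult f x h) = deg h"
    using biword_wreath_mult[OF assms(3), of f] by (metis length_act length_biword)
  have act: "act f (map (apfst (enum (letters w))) (biword x)) (biword h)
      = map (apfst (enum (letters w))) (biword (wreath_mult f x h))"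
    by (subst act_map_apfst) (simp_all add: biword_wreath_mult assms)
  show ?thesis
    unfolding act using Std_relabel(1)[of "letters w" "wreath_mult f x h"]
      unstandardize[OF assms(1)] card_letters[OF assms(1)] deg assms(2) by auto
qed

lemma coef_star_G:
  "coef (star f (G h) A) g =
    (\<Sum>x\<in>{x \<in> supp A. deg x = deg h \<and> wreath_mult f x h = g}. coef A x)"
proof -
  have "coef (star f (G h) A) g = (\<Sum>x\<in>supp A. coef A x * coef (star_basis f h x) g)"
    unfolding star_def G_def bilin_ext_basis_left
    by (rule lookup_lin_ext) auto
  also have "\<dots> = (\<Sum>x\<in>supp A. if deg x = deg h \<and> wreath_mult f x h = g then coef A x else 0)"
    by (rule sum.cong) (auto simp: star_basis_def G_def lookup_basis)
  finally show ?thesis by (simp add: sum.inter_filter)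
qed

lemma deg_wreath_mult: "deg x = deg h \<Longrightarrow> deg (wreath_mult f x h) = deg h"
  using biword_wreath_mult[of x h f] by (metis length_act length_biword)

text \<open>The colored permutations \<open>x\<close> whose wreath product with \<open>h\<close> is
  \<open>Std w\<close> are replaced by their relabelings \<open>y\<close> on the letters of
  \<open>w\<close>. All colors in the support of \<open>A\<close> lie in \<open>K\<close>, so
  restricting to \<open>rewords K w\<close> loses no nonzero term.\<close>

lemma wcoef_star_G:
  assumes w: "distinct_letters w" and len: "length w = deg h"
    and K: "finite K" "color_set A \<subseteq> K"
  shows "wcoef (star f (G h) A) w = (\<Sum>y\<in>{y \<in> rewords K w. act f y (biword h) = w}. wcoef A y)"
    (is "_ = sum _ ?Y")
proof -
  let ?r = "\<lambda>x. map (apfst (enum (letters w))) (biword x)"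
  let ?X = "{x \<in> supp A. deg x = deg h \<and> wreath_mult f x h = Std w}"
  have Std_r: "Std (?r x) = x" and r_mem: "distinct_letters (?r x)" "letters (?r x) = letters w"
    if "deg x = deg h" for x
    using Std_relabel[of "letters w" x] that len card_letters[OF w] by auto
  have "(\<Sum>x\<in>?X. coef A x) = (\<Sum>y\<in>?Y. wcoef A y)"
  proof (rule sum.reindex_bij_witness_not_neutral[where i = Std and j = ?r and S' = "{}"
        and T' = "{y \<in> ?Y. Std y \<notin> supp A}"])
    show "finite {y \<in> ?Y. Std y \<notin> supp A}"
      by (rule finite_subset[OF _ finite_rewords[OF w K(1)]]) auto
  next
    fix x assume "x \<in> ?X - {}"
    then have x: "x \<in> supp A" "deg x = deg h" "wreath_mult f x h = Std w" by auto
    show "Std (?r x) = x" using Std_r x by blast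
    have "snd ` set (?r x) = snd ` set (biword x)" by (simp add: image_image)
    then have "?r x \<in> rewords K w"
      using r_mem[OF x(2)] K(2) x(1) unfolding rewords_def color_set_def by blast
    then show "?r x \<in> ?Y - {y \<in> ?Y. Std y \<notin> supp A}"
      using x(1,3) Std_r[OF x(2)] act_relabel_iff[OF w len x(2), of f] by simp
  next
    fix y assume y: "y \<in> ?Y - {y \<in> ?Y. Std y \<notin> supp A}"
    then have "distinct_letters y" "letters y = letters w" by (auto simp: rewords_def)
    then show r: "?r (Std y) = y" using unstandardize by metis
    have "deg (Std y) = deg h"
      using y length_rewords[OF w] len by (auto simp: rewords_def)
    then show "Std y \<in> ?X - {}"
      using y act_relabel_iff[OF w len, of "Std y" f] r by auto
  next
    fix x assume "x \<in> ?X"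
    then show "wcoef A (?r x) = coef A x" by (simp only: Std_r mem_Collect_eq)
  qed (auto simp: in_keys_iff)
  then show ?thesis by (simp add: coef_star_G)
qed

text \<open>\<open>glue Z h h'\<close> is the element of the convolution of \<open>h\<close> and \<open>h'\<close> in which \<open>h\<close> uses the
  letters \<open>Z\<close>; acting by it first selects the subwords at the places \<open>Z\<close> and not in \<open>Z\<close>.\<close>

definition glue :: "nat set \<Rightarrow> 'c colperm \<Rightarrow> 'c colperm \<Rightarrow> (nat \<times> 'c) list" where
  "glue Z h h' = map (apfst (enum Z)) (biword h) @
     map (apfst (enum ({1..deg h + deg h'} - Z))) (biword h')"

text \<open>The two parts carry complementary letter sets, so their concatenation is already a
  permutation word, and \<open>Z\<close> is visible as the set of letters of the first part.\<close>

lemma glue: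
  assumes "Z \<subseteq> {1..deg h + deg h'}" "card Z = deg h"
  shows "biword (Std (glue Z h h')) = glue Z h h'" "distinct_letters (glue Z h h')"
    "letters (glue Z h h') = {1..deg h + deg h'}"
    "Std (take (deg h) (glue Z h h')) = h" "Std (drop (deg h) (glue Z h h')) = h'"
    "letters (take (deg h) (glue Z h h')) = Z"
proof -
  let ?Z' = "{1..deg h + deg h'} - Z"
  have fin: "finite Z" using assms(1) finite_subset by blast
  then have "card ?Z' = deg h'" using assms by (simp add: card_Diff_subset)
  note Z = Std_relabel[OF fin assms(2)] and Z' = Std_relabel[of ?Z', OF _ this]
  show "letters (glue Z h h') = {1..deg h + deg h'}"
    using Z Z' assms(1) unfolding glue_def by (auto simp: image_Un simp del: set_map)
  moreover show "distinct_letters (glue Z h h')"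
    using Z(2,3) Z'(2,3) unfolding glue_def map_append distinct_append set_map by blast
  ultimately show "biword (Std (glue Z h h')) = glue Z h h'"
    by (rule biword_Std_permutation[rotated])
  show "Std (take (deg h) (glue Z h h')) = h" "Std (drop (deg h) (glue Z h h')) = h'"
    "letters (take (deg h) (glue Z h h')) = Z"
    using Z Z' by (simp_all add: glue_def del: set_map)
qed

abbreviation blocks :: "nat \<Rightarrow> nat \<Rightarrow> nat set set" where
  "blocks p q \<equiv> {Z. Z \<subseteq> {1..p + q} \<and> card Z = p}"

text \<open>A member of the convolution is determined by the set \<open>Z\<close> of its first
  \<open>deg h\<close> letters, and every \<open>Z\<close> of the right size occurs.\<close>

lemma fq_mult_G_G: "fq_mult (G h) (G h') = (\<Sum>Z\<in>blocks (deg h) (deg h'). G (Std (glue Z h h')))"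
proof -
  let ?B = "blocks (deg h) (deg h')"
  have "conv_colperms h h' = (\<lambda>Z. Std (glue Z h h')) ` ?B"
  proof (rule set_eqI)
    fix g
    show "g \<in> conv_colperms h h' \<longleftrightarrow> g \<in> (\<lambda>Z. Std (glue Z h h')) ` ?B"
    proof
      assume "g \<in> conv_colperms h h'"
      then have g: "deg g = deg h + deg h'" "Std (take (deg h) (biword g)) = h"
          "Std (drop (deg h) (biword g)) = h'"
        using in_conv_colperms_iff[of "biword g" h h'] by auto
      define Z where "Z = letters (take (deg h) (biword g))"
      have disj: "letters (take (deg h) (biword g)) \<inter> letters (drop (deg h) (biword g)) = {}"
        using distinct_letters_biword[of g]
        by (subst (asm) append_take_drop_id[of "deg h", symmetric]) (simp only: map_append distinct_append set_map)
      have un: "letters (take (deg h) (biword g)) \<union> letters (drop (deg h) (biword g)) = {1..deg g}"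
        by (metis append_take_drop_id image_Un letters_biword set_append)
      have Z: "Z \<in> ?B"
        using un card_letters[OF distinct_letters_take[OF distinct_letters_biword[of g]], of "deg h"] g(1)
        by (auto simp: Z_def min_absorb1 simp del: One_nat_def)
      have "letters (drop (deg h) (biword g)) = {1..deg h + deg h'} - Z"
        using disj un unfolding g(1) Z_def by blast
      then have c: "{1..deg h + deg h'} - Z = letters (drop (deg h) (biword g))" by (rule sym)
      have "map (apfst (enum (letters (take (deg h) (biword g))))) (biword h) = take (deg h) (biword g)"
        using unstandardize[OF distinct_letters_take[OF distinct_letters_biword[of g]], of "deg h"]
        unfolding g(2) .
      moreover have "map (apfst (enum (letters (drop (deg h) (biword g))))) (biword h') = drop (deg h) (biword g)"
        using unstandardize[OF distinct_letters_drop[OF distinct_letters_biword[of g]], of "deg h"]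
        unfolding g(3) .
      ultimately have "glue Z h h' = take (deg h) (biword g) @ drop (deg h) (biword g)"
        unfolding glue_def c unfolding Z_def by (simp only:)
      then have "glue Z h h' = biword g" by simp
      then have "g = Std (glue Z h h')" by simp
      then show "g \<in> (\<lambda>Z. Std (glue Z h h')) ` ?B" using Z by (rule image_eqI)
    next
      assume "g \<in> (\<lambda>Z. Std (glue Z h h')) ` ?B"
      then obtain Z where "Z \<in> ?B" "g = Std (glue Z h h')" by blast
      moreover have "length (glue Z h h') = deg h + deg h'" for Z by (simp add: glue_def)
      ultimately show "g \<in> conv_colperms h h'"
        using glue[of Z h h'] in_conv_colperms_iff[of "glue Z h h'" h h'] by blast
    qed
  qed
  moreover have "inj_on (\<lambda>Z. Std (glue Z h h')) ?B"
    by (rule inj_onI) (metis (mono_tags, lifting) glue(1,6) mem_Collect_eq)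
  ultimately have "(\<Sum>g\<in>conv_colperms h h'. G g) = (\<Sum>Z\<in>?B. G (Std (glue Z h h')))"
    by (simp only: sum.reindex o_def)
  then show ?thesis by (simp add: fq_mult_def G_def[of h] G_def[of h'])
qed

text \<open>Places are counted from 1, like letters. Members of \<open>Z\<close> that are not places
  of \<open>x\<close> are ignored, so \<open>Z\<close> may be an infinite complement.\<close>

definition sel :: "'a list \<Rightarrow> nat set \<Rightarrow> 'a list" where
  "sel x Z = map (\<lambda>i. x ! (i - 1)) (filter (\<lambda>i. i \<in> Z) [1..<Suc (length x)])"

lemma filter_upt_eq_sorted_list_of_set:
  assumes "Z \<subseteq> {1..n}"
  shows "filter (\<lambda>i. i \<in> Z) [1..<Suc n] = sorted_list_of_set Z"
proof (rule sorted_distinct_set_unique)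
  have "finite Z" using assms finite_subset by blast
  then show "set (filter (\<lambda>i. i \<in> Z) [1..<Suc n]) = set (sorted_list_of_set Z)"
    using assms by (auto simp del: upt_Suc)
qed (auto intro: sorted_wrt_filter simp del: upt_Suc)

lemma sel_eq: "Z \<subseteq> {1..length x} \<Longrightarrow> sel x Z = map (\<lambda>i. x ! (i - 1)) (sorted_list_of_set Z)"
  unfolding sel_def using filter_upt_eq_sorted_list_of_set by metis

lemma length_sel: "Z \<subseteq> {1..length x} \<Longrightarrow> length (sel x Z) = card Z"
  by (simp add: sel_eq)

lemma map_nth_upt: "map (\<lambda>i. x ! (i - 1)) [1..<Suc (length x)] = x"
  by (rule nth_equalityI) (simp_all del: upt_Suc)

lemma map_shuffles: "w \<in> shuffles xs ys \<Longrightarrow> map g w \<in> shuffles (map g xs) (map g ys)"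
proof (induction xs ys arbitrary: w rule: shuffles.induct)
  case (3 x xs y ys)
  then show ?case by (cases w) (auto simp: Cons_in_shuffles_iff)
qed auto

text \<open>The list of places is a shuffle of the places in \<open>Z\<close> and the others, and
  mapping a function over a shuffle gives a shuffle.\<close>

lemma sel_shuffle: "x \<in> shuffles (sel x Z) (sel x (- Z))"
  using map_shuffles[OF partition_in_shuffles[of "[1..<Suc (length x)]" "\<lambda>i. i \<in> Z"],
      of "\<lambda>i. x ! (i - 1)"]
  unfolding sel_def map_nth_upt by (simp only: Compl_iff)

lemma sel_complement: "sel x ({1..length x} - Z) = sel x (- Z)"
  unfolding sel_def by (intro arg_cong[where f = "map _"] filter_cong) (auto simp del: upt_Suc)

lemma sel_positions: "sel x {i. x ! (i - 1) \<in> A} = filter (\<lambda>e. e \<in> A) x"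
proof -
  have "filter (\<lambda>e. e \<in> A) (map (\<lambda>i. x ! (i - 1)) [1..<Suc (length x)]) = sel x {i. x ! (i - 1) \<in> A}"
    by (simp add: sel_def filter_map o_def del: upt_Suc)
  then show ?thesis by (simp only: map_nth_upt)
qed

lemma sel_Int: "sel x ({1..length x} \<inter> Z) = sel x Z"
  unfolding sel_def by (intro arg_cong[where f = "map _"] filter_cong) (auto simp del: upt_Suc)

lemma sel_Compl_Int: "sel x (- ({1..length x} \<inter> Z)) = sel x (- Z)"
  unfolding sel_def by (intro arg_cong[where f = "map _"] filter_cong) (auto simp del: upt_Suc)

text \<open>With distinct entries, no place outside \<open>Z\<close> carries an entry of the
  selected subword, so \<open>x\<close> and the subword determine \<open>Z\<close>.\<close>

lemma positions_sel:
  assumes "distinct x" "Z \<subseteq> {1..length x}"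
  shows "{1..length x} \<inter> {i. x ! (i - 1) \<in> set (sel x Z)} = Z"
proof -
  have "finite Z" using assms(2) finite_subset by blast
  then have s: "set (sel x Z) = (\<lambda>i. x ! (i - 1)) ` Z" by (simp add: sel_eq[OF assms(2)])
  have inj: "inj_on (\<lambda>i. x ! (i - 1)) {1..length x}"
  proof (rule inj_onI)
    fix i j assume ij: "i \<in> {1..length x}" "j \<in> {1..length x}" "x ! (i - 1) = x ! (j - 1)"
    then have "i - 1 = j - 1" using nth_eq_iff_index_eq[OF assms(1), of "i - 1" "j - 1"] by auto
    then show "i = j" using ij by auto
  qed
  have "x ! (i - 1) \<in> (\<lambda>i. x ! (i - 1)) ` Z \<longleftrightarrow> i \<in> Z" if "i \<in> {1..length x}" for i
    using inj_on_image_mem_iff[OF inj that assms(2)] .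
  then show ?thesis unfolding s using assms(2) by blast
qed

text \<open>The \<open>t\<close>-th smallest place in \<open>Z\<close> is where the
  \<open>t\<close>-th entry of the selected subword stands, so renaming the letters of
  \<open>b\<close> amounts to selecting from \<open>x\<close> first.\<close>

lemma act_map_enum:
  assumes "Z \<subseteq> {1..length x}" "letters b = {1..card Z}"
  shows "act f x (map (apfst (enum Z)) b) = act f (sel x Z) b"
proof -
  have "x ! (enum Z t - 1) = sel x Z ! (t - 1)" if "(t, c) \<in> set b" for t c
  proof -
    have "t \<in> {1..card Z}" using assms(2) that by force
    then have "t - 1 < length (sorted_list_of_set Z)" by auto
    then show ?thesis by (simp add: sel_eq[OF assms(1)] enum_def)
  qed
  then show ?thesis by (auto simp: act_def)
qed

lemma act_glue:
  assumes "Z \<in> blocks (deg h) (deg h')" "length x = deg h + deg h'"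
  shows "act f x (glue Z h h') = act f (sel x Z) (biword h) @ act f (sel x (- Z)) (biword h')"
proof -
  have "finite Z" using assms(1) finite_subset by blast
  then have "card ({1..length x} - Z) = deg h'" using assms by (simp add: card_Diff_subset)
  then show ?thesis
    using assms by (simp add: glue_def act_append act_map_enum sel_complement[symmetric] del: One_nat_def)
qed

lemma finite_blocks: "finite (blocks p q)"
  by (rule finite_subset[of _ "Pow {1..p + q}"]) auto

lemma wcoef_star_G_degree:
  assumes "distinct_letters w" "length w \<noteq> deg h"
  shows "wcoef (star f (G h) A) w = 0"
proof -
  have "wreath_mult f x h \<noteq> Std w" if "deg x = deg h" for x
    using deg_wreath_mult[OF that, of f] deg_Std[OF assms(1)] assms(2) by metis
  then show ?thesis unfolding coef_star_G by (intro sum.neutral) blast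
qed

text \<open>The list \<open>L\<close> stands for the sum of the tensors of its pairs; as a list it
  admits repeated pairs. The letters of \<open>v\<close> and \<open>w\<close> may interleave in any
  relative order.\<close>

definition splitting :: "(('c, 'k) fqsym \<times> ('c, 'k) fqsym) list \<Rightarrow> ('c, 'k::comm_ring_1) fqsym \<Rightarrow> bool" where
  "splitting L H \<longleftrightarrow> (\<forall>v w. distinct_letters (v @ w) \<longrightarrow>
     shuffle_sum H v w = (\<Sum>(A, B)\<leftarrow>L. wcoef A v * wcoef B w))"

text \<open>Expanding the product over \<open>Z\<close> gives words \<open>x\<close> whose subwords
  at \<open>Z\<close> and at its complement are carried to the prefix and the suffix of
  \<open>w\<close>. Such a pair \<open>(Z, x)\<close> is the same as two words \<open>y\<close> and
  \<open>z\<close> with a shuffle \<open>x\<close> of them, \<open>Z\<close> being the set of places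
  of \<open>y\<close> in \<open>x\<close>.\<close>

lemma star_fq_mult_G_G_shuffle:
  assumes w: "distinct_letters w" and len: "length w = deg h + deg h'"
    and K: "finite K" "color_set H \<subseteq> K"
  shows "wcoef (star f (fq_mult (G h) (G h')) H) w =
    (\<Sum>y\<in>{y \<in> rewords K (take (deg h) w). act f y (biword h) = take (deg h) w}.
     \<Sum>z\<in>{z \<in> rewords K (drop (deg h) w). act f z (biword h') = drop (deg h) w}. shuffle_sum H y z)"
proof -
  let ?a = "take (deg h) w" and ?b = "drop (deg h) w" and ?B = "blocks (deg h) (deg h')"
  let ?X = "\<lambda>Z. {x \<in> rewords K w. act f (sel x Z) (biword h) = ?a \<and> act f (sel x (- Z)) (biword h') = ?b}"
  let ?Y = "{y \<in> rewords K ?a. act f y (biword h) = ?a}" and ?Y' = "{z \<in> rewords K ?b. act f z (biword h') = ?b}"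
  have da: "distinct_letters ?a" and db: "distinct_letters ?b"
    using w by (simp_all add: distinct_letters_take distinct_letters_drop)
  have lw: "letters w = letters ?a \<union> letters ?b"
    by (simp only: append_take_drop_id flip: image_Un set_append)
  have disj: "letters ?a \<inter> letters ?b = {}"
    using w by (subst (asm) append_take_drop_id[of "deg h", symmetric],
        simp only: map_append distinct_append set_map)
  have lX: "length x = deg h + deg h'" if "x \<in> rewords K w" for x
    using length_rewords[OF w that] len by simp
  have "wcoef (star f (fq_mult (G h) (G h')) H) w = (\<Sum>Z\<in>?B. wcoef (star f (G (Std (glue Z h h'))) H) w)"
    by (simp add: fq_mult_G_G linear_map_sum[OF linear_map_star_left] lookup_sum)
  also have "\<dots> = (\<Sum>Z\<in>?B. \<Sum>x\<in>?X Z. wcoef H x)"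
  proof (rule sum.cong[OF refl])
    fix Z assume Z: "Z \<in> ?B"
    then have g: "biword (Std (glue Z h h')) = glue Z h h'" using glue(1) by blast
    have "act f x (glue Z h h') = w \<longleftrightarrow> act f (sel x Z) (biword h) = ?a \<and> act f (sel x (- Z)) (biword h') = ?b"
      if "x \<in> rewords K w" for x
      unfolding act_glue[OF Z lX[OF that]] by (auto simp: append_eq_conv_conj)
    moreover have "deg (Std (glue Z h h')) = length w"
      using g len by (metis glue_def length_append length_biword length_map)
    ultimately show "wcoef (star f (G (Std (glue Z h h'))) H) w = (\<Sum>x\<in>?X Z. wcoef H x)"
      by (subst wcoef_star_G[OF w _ K]) (auto simp: g intro!: sum.cong)
  qed
  also have "\<dots> = (\<Sum>(Z, x)\<in>Sigma ?B ?X. wcoef H x)"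
    by (rule sum.Sigma) (use finite_blocks finite_rewords[OF w K(1)] in auto)
  also have "\<dots> = (\<Sum>(y, z, x)\<in>Sigma ?Y (\<lambda>y. Sigma ?Y' (\<lambda>z. shuffles y z)). wcoef H x)"
  proof (rule sum.reindex_bij_witness[where i = "\<lambda>(y, z, x). ({1..length x} \<inter> {i. x ! (i - 1) \<in> set y}, x)"
        and j = "\<lambda>(Z, x). (sel x Z, sel x (- Z), x)"], goal_cases)
    case (1 u)
    then obtain Z x where u: "u = (Z, x)" "Z \<in> ?B" "x \<in> ?X Z" by auto
    then have "distinct x" "Z \<subseteq> {1..length x}"
      using lX by (auto simp: rewords_def simp: distinct_map)
    then show ?case using positions_sel u(1) by simp
  next
    case (2 u)
    then obtain Z x where u: "u = (Z, x)" "Z \<in> ?B" "x \<in> ?X Z" by auto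
    have dx: "distinct_letters x" and Z: "Z \<subseteq> {1..length x}" and x: "letters x = letters w" "snd ` set x \<subseteq> K"
      using u lX by (auto simp: rewords_def)
    have sh: "x \<in> shuffles (sel x Z) (sel x (- Z))" by (rule sel_shuffle)
    have l1: "length (sel x Z) = deg h" using u Z by (simp add: length_sel)
    then have l2: "length (sel x (- Z)) = deg h'" using length_shuffles[OF sh] lX u by auto
    \<comment> \<open>Acting by a colored permutation preserves the set of letters, so each subword
      has the letters of its image.\<close>
    have "letters (sel x Z) = letters ?a" "letters (sel x (- Z)) = letters ?b"
      using letters_act[of "biword h" "sel x Z" f] letters_act[of "biword h'" "sel x (- Z)" f] l1 l2 u(3)
      by auto
    moreover have "distinct_letters (sel x Z)" "distinct_letters (sel x (- Z))"
      using distinct_letters_shuffles[OF sh] dx by auto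
    moreover have "set (sel x Z) \<subseteq> set x" "set (sel x (- Z)) \<subseteq> set x"
      using set_shuffles[OF sh] by auto
    ultimately have "sel x Z \<in> rewords K ?a" "sel x (- Z) \<in> rewords K ?b"
      using x(2) unfolding rewords_def mem_Collect_eq by (intro conjI; blast)+
    then have "sel x Z \<in> ?Y" "sel x (- Z) \<in> ?Y'" using u(3) by simp_all
    then show ?case using u(1) sh by simp
  next
    case (3 v)
    then obtain y z x where v: "v = (y, z, x)" "y \<in> ?Y" "z \<in> ?Y'" "x \<in> shuffles y z" by auto
    have "letters y \<inter> letters z = {}" using v(2,3) disj by (auto simp: rewords_def)
    then have "set y \<inter> set z = {}" by blast
    then have "filter (\<lambda>e. e \<in> set y) x = y" "filter (\<lambda>e. e \<notin> set y) x = z"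
      using filter_shuffle[OF v(4), of "\<lambda>e. e \<in> set y"] by auto
    then have "sel x {i. x ! (i - 1) \<in> set y} = y" "sel x (- {i. x ! (i - 1) \<in> set y}) = z"
      using sel_positions[of x "set y"] sel_positions[of x "- set y"] by (auto simp: Collect_neg_eq)
    then show ?case by (simp only: v(1) sel_Int sel_Compl_Int case_prod_conv)
  next
    case (4 v)
    then obtain y z x where v: "v = (y, z, x)" "y \<in> ?Y" "z \<in> ?Y'" "x \<in> shuffles y z" by auto
    have "letters y \<inter> letters z = {}" using v(2,3) disj by (auto simp: rewords_def)
    then have "set y \<inter> set z = {}" by blast
    then have "filter (\<lambda>e. e \<in> set y) x = y" "filter (\<lambda>e. e \<notin> set y) x = z"
      using filter_shuffle[OF v(4), of "\<lambda>e. e \<in> set y"] by auto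
    then have s: "sel x {i. x ! (i - 1) \<in> set y} = y" "sel x (- {i. x ! (i - 1) \<in> set y}) = z"
      using sel_positions[of x "set y"] sel_positions[of x "- set y"] by (auto simp: Collect_neg_eq)
    define Z where "Z = {1..length x} \<inter> {i. x ! (i - 1) \<in> set y}"
    have sZ: "sel x Z = y" "sel x (- Z) = z"
      using s unfolding Z_def sel_Int sel_Compl_Int by simp_all
    have ly: "length y = deg h" "length z = deg h'"
      using length_rewords[OF da, of y K] length_rewords[OF db, of z K] v(2,3) len by simp_all
    then have lx: "length x = deg h + deg h'" using length_shuffles[OF v(4)] by simp
    have "Z \<in> ?B"
      using length_sel[of Z x] sZ(1) ly(1) lx by (auto simp: Z_def simp del: One_nat_def)
    moreover have "x \<in> rewords K w"
    proof -
      have y: "distinct_letters y" "letters y = letters ?a" "snd ` set y \<subseteq> K"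
        and z: "distinct_letters z" "letters z = letters ?b" "snd ` set z \<subseteq> K"
        using v(2,3) by (simp_all add: rewords_def)
      have "distinct_letters (y @ z)"
        unfolding map_append distinct_append set_map y(2) z(2) using y(1) z(1) disj by blast
      then have "distinct_letters x" using distinct_letters_shuffles[OF v(4)] by blast
      moreover have "letters x = letters w"
        unfolding set_shuffles[OF v(4)] lw image_Un y(2) z(2) ..
      moreover have "snd ` set x \<subseteq> K"
        unfolding set_shuffles[OF v(4)] image_Un using y(3) z(3) by blast
      ultimately show ?thesis by (simp add: rewords_def)
    qed
    ultimately have "(Z, x) \<in> Sigma ?B ?X" using v sZ by blast
    then show ?case unfolding v(1) case_prod_conv Z_def .
  next
    case (5 u)
    then show ?case by auto
  qed
  also have "\<dots> = (\<Sum>y\<in>?Y. \<Sum>z\<in>?Y'. shuffle_sum H y z)"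
    unfolding shuffle_sum_def
    using finite_rewords[OF da K(1)] finite_rewords[OF db K(1)]
    by (subst sum.Sigma[symmetric], simp, simp, subst sum.Sigma, simp_all)
  finally show ?thesis .
qed

lemma sum_list_sum_commute: "(\<Sum>x\<in>A. \<Sum>l\<leftarrow>L. g x l) = (\<Sum>l\<leftarrow>L. \<Sum>x\<in>A. g x l)"
  by (induction L) (auto simp: sum.distrib)

lemma coef_sum_list: "coef (\<Sum>l\<leftarrow>L. F l) x = (\<Sum>l\<leftarrow>L. coef (F l) x)"
  by (induction L) (auto simp: lookup_add)

lemma star_fq_mult_G_G:
  assumes "splitting L H"
  shows "star f (fq_mult (G h) (G h')) H = (\<Sum>(A, B)\<leftarrow>L. fq_mult (star f (G h) A) (star f (G h') B))"
proof (rule fqsym_eqI)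
  fix w :: "(nat \<times> 'a) list" assume w: "distinct_letters w"
  note da = distinct_letters_take[OF w] and db = distinct_letters_drop[OF w]
  \<comment> \<open>\<open>star f (G h) A\<close> vanishes on words whose length is not
    \<open>deg h\<close>, so at most one cut of \<open>w\<close> survives.\<close>
  have rhs: "wcoef (fq_mult (star f (G h) A) (star f (G h') B)) w =
      (if length w = deg h + deg h' then wcoef (star f (G h) A) (take (deg h) w)
        * wcoef (star f (G h') B) (drop (deg h) w) else 0)" for A B :: "('a, 'b) fqsym"
  proof -
    have "wcoef (fq_mult (star f (G h) A) (star f (G h') B)) w =
      (\<Sum>p\<le>length w. if p = deg h \<and> length w = deg h + deg h' then wcoef (star f (G h) A) (take (deg h) w)
        * wcoef (star f (G h') B) (drop (deg h) w) else 0)"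
      unfolding wcoef_fq_mult[OF w]
    proof (rule sum.cong[OF refl])
      fix p assume "p \<in> {..length w}"
      then show "wcoef (star f (G h) A) (take p w) * wcoef (star f (G h') B) (drop p w) =
         (if p = deg h \<and> length w = deg h + deg h' then wcoef (star f (G h) A) (take (deg h) w)
        * wcoef (star f (G h') B) (drop (deg h) w) else 0)"
        using wcoef_star_G_degree[OF da, of p h f A] wcoef_star_G_degree[OF db, of p h' f B]
        by (cases "p = deg h"; cases "length w = deg h + deg h'") auto
    qed
    then show ?thesis by auto
  qed
  show "wcoef (star f (fq_mult (G h) (G h')) H) w
      = wcoef (\<Sum>(A, B)\<leftarrow>L. fq_mult (star f (G h) A) (star f (G h') B)) w"
  proof (cases "length w = deg h + deg h'")
    case True
    \<comment> \<open>One set of colors has to serve for \<open>H\<close> and for all pairs in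
      \<open>L\<close>, since the sums over rewords are compared term by term.\<close>
    define K where "K = color_set H \<union> (\<Union>(A, B)\<in>set L. color_set A \<union> color_set B)"
    have K: "finite K" "color_set H \<subseteq> K" by (auto simp: K_def finite_color_set)
    have KL: "color_set A \<subseteq> K" "color_set B \<subseteq> K" if "(A, B) \<in> set L" for A B
      using that by (auto simp: K_def)
    let ?a = "take (deg h) w" and ?b = "drop (deg h) w"
    let ?Y = "{y \<in> rewords K ?a. act f y (biword h) = ?a}" and ?Y' = "{z \<in> rewords K ?b. act f z (biword h') = ?b}"
    have disj: "letters ?a \<inter> letters ?b = {}"
      using w by (subst (asm) append_take_drop_id[of "deg h", symmetric])
        (simp only: map_append distinct_append set_map)
    have "wcoef (star f (fq_mult (G h) (G h')) H) w = (\<Sum>y\<in>?Y. \<Sum>z\<in>?Y'. shuffle_sum H y z)"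
      by (rule star_fq_mult_G_G_shuffle[OF w True K])
    also have "\<dots> = (\<Sum>y\<in>?Y. \<Sum>z\<in>?Y'. \<Sum>(A, B)\<leftarrow>L. wcoef A y * wcoef B z)"
    proof (intro sum.cong refl)
      fix y z assume "y \<in> ?Y" "z \<in> ?Y'"
      then have "distinct_letters (y @ z)" using disj by (auto simp: rewords_def)
      then show "shuffle_sum H y z = (\<Sum>(A, B)\<leftarrow>L. wcoef A y * wcoef B z)"
        using assms by (simp add: splitting_def)
    qed
    also have "\<dots> = (\<Sum>(A, B)\<leftarrow>L. (\<Sum>y\<in>?Y. wcoef A y) * (\<Sum>z\<in>?Y'. wcoef B z))"
      unfolding sum_list_sum_commute by (simp only: sum_product case_prod_unfold)
    also have "\<dots> = (\<Sum>(A, B)\<leftarrow>L. wcoef (star f (G h) A) ?a * wcoef (star f (G h') B) ?b)"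
      using True by (intro arg_cong[where f = sum_list] map_cong refl)
        (auto simp: wcoef_star_G[OF da _ K(1) KL(1)] wcoef_star_G[OF db _ K(1) KL(2)])
    also have "\<dots> = wcoef (\<Sum>(A, B)\<leftarrow>L. fq_mult (star f (G h) A) (star f (G h') B)) w"
      using True by (simp add: coef_sum_list case_prod_unfold rhs)
    finally show ?thesis .
  next
    case False
    have "wcoef (star f (G (Std (glue Z h h'))) H) w = 0" if Z: "Z \<in> blocks (deg h) (deg h')" for Z
    proof (rule wcoef_star_G_degree[OF w])
      show "length w \<noteq> deg (Std (glue Z h h'))"
        using False glue(2)[of Z h h'] Z by (simp add: glue_def)
    qed
    then have "wcoef (star f (fq_mult (G h) (G h')) H) w = 0"
      by (simp add: fq_mult_G_G linear_map_sum[OF linear_map_star_left] lookup_sum)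
    then show ?thesis using False by (simp add: coef_sum_list case_prod_beta rhs)
  qed
qed

text \<open>The same list \<open>L\<close> serves all \<open>F1\<close> and \<open>F2\<close>, so
  both sides are bilinear in them and the case of basis elements suffices.\<close>

lemma star_fq_mult:
  assumes "splitting L H"
  shows "star f (fq_mult F1 F2) H = (\<Sum>(A, B)\<leftarrow>L. fq_mult (star f F1 A) (star f F2 B))"
  apply (rule bilinear_eqI[where \<phi> = "\<lambda>F1 F2. star f (fq_mult F1 F2) H" and
      \<psi> = "\<lambda>F1 F2. \<Sum>(A, B)\<leftarrow>L. fq_mult (star f F1 A) (star f F2 B)"])
  subgoal by (rule linear_map_comp[OF linear_map_star_left linear_map_fq_mult_left])
  subgoal by (rule linear_map_comp[OF linear_map_star_left linear_map_fq_mult_right])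
  subgoal unfolding case_prod_beta
    by (intro linear_map_sum_list_fun linear_map_comp[OF linear_map_fq_mult_left linear_map_star_left])
  subgoal unfolding case_prod_beta
    by (intro linear_map_sum_list_fun linear_map_comp[OF linear_map_fq_mult_right linear_map_star_left])
  subgoal using star_fq_mult_G_G[OF assms] unfolding G_def .
  done

section \<open>The subalgebra of the complete functions\<close>

lemma subalgebra_Sym: "is_subalgebra fq_mult (Sym :: ('c, 'k::comm_ring_1) fqsym set)"
  unfolding Sym_def by (rule hull_in) (auto simp: is_subalgebra_def)

lemma Sym_zero: "0 \<in> Sym"
  and Sym_add: "F \<in> Sym \<Longrightarrow> H \<in> Sym \<Longrightarrow> F + H \<in> Sym"
  and Sym_scale: "F \<in> Sym \<Longrightarrow> scale a F \<in> Sym"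
  and Sym_fq_mult: "F \<in> Sym \<Longrightarrow> H \<in> Sym \<Longrightarrow> fq_mult F H \<in> Sym"
  using subalgebra_Sym by (auto simp: is_subalgebra_def)

lemma Sym_S: "S v \<in> Sym"
  unfolding Sym_def by (rule hull_inc) simp

lemma Sym_sum: "(\<And>i. i \<in> I \<Longrightarrow> F i \<in> Sym) \<Longrightarrow> (\<Sum>i\<in>I. F i) \<in> Sym"
  by (induction I rule: infinite_finite_induct) (auto simp: Sym_zero Sym_add)

lemma Sym_sum_list: "(\<And>i. i \<in> set L \<Longrightarrow> F i \<in> Sym) \<Longrightarrow> (\<Sum>i\<leftarrow>L. F i) \<in> Sym"
  by (induction L) (auto simp: Sym_zero Sym_add)

lemma Sym_induct [consumes 1, case_names S zero add scale mult]:
  assumes "F \<in> Sym" "\<And>v. P (S v)" "P 0" "\<And>F H. P F \<Longrightarrow> P H \<Longrightarrow> P (F + H)"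
    "\<And>a F. P F \<Longrightarrow> P (scale a F)" "\<And>F H. P F \<Longrightarrow> P H \<Longrightarrow> P (fq_mult F H)"
  shows "P F"
  using assms(1) unfolding Sym_def
  by (rule hull_induct) (use assms(2-) in \<open>auto simp: is_subalgebra_def\<close>)

text \<open>This is \<open>S\<close> indexed by a multiset of colors instead of a vector (see
  \<open>S_eq_complete\<close>), which gives direct access to contents of words and to
  submultisets.\<close>

definition complete_fn :: "'c multiset \<Rightarrow> ('c, 'k::comm_ring_1) fqsym" where
  "complete_fn A = (\<Sum>u\<in>permutations_of_multiset A. G (id_colored u))"

definition content :: "('c \<Rightarrow>\<^sub>0 nat) \<Rightarrow> 'c multiset" where
  "content v = (\<Sum>c\<in>supp v. replicate_mset (coef v c) c)"

lemma count_content [simp]: "count (content v) c = coef v c"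
  by (simp add: content_def count_sum sum.delta if_distrib in_keys_iff cong: if_cong)

lemma size_content: "size (content v) = weight v"
  by (simp add: content_def weight_def size_multiset_sum)

lemma content_surj: "\<exists>v. content v = A"
proof
  have "{c. count A c \<noteq> 0} = set_mset A"
    by (simp only: count_eq_zero_iff not_not Collect_mem_eq)
  then have "finite {c. count A c \<noteq> 0}" by simp
  then show "content (Abs_poly_mapping (count A)) = A"
    by (intro multiset_eqI) (simp only: count_content lookup_Abs_poly_mapping)
qed

lemma S_eq_complete: "S v = complete_fn (content v)"
proof -
  have "length u = weight v \<and> (\<forall>c. count_list u c = coef v c) \<longleftrightarrow> mset u = content v" for u
  proof
    assume "mset u = content v"
    then show "length u = weight v \<and> (\<forall>c. count_list u c = coef v c)"
      by (metis count_content count_mset size_content size_mset)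
  qed (auto intro!: multiset_eqI simp: count_mset)
  then show ?thesis by (simp add: S_def complete_fn_def permutations_of_multiset_def)
qed

lemma Sym_complete: "complete_fn A \<in> Sym"
  using content_surj[of A] Sym_S S_eq_complete by metis

section \<open>Complete functions as functions on words\<close>

lemma biword_id_colored: "biword (id_colored u) = zip [1..<Suc (length u)] u"
  by (rule id_colored.rep_eq)

lemma perm_id_colored: "perm (id_colored u) = [1..<Suc (length u)]"
  and colors_id_colored: "colors (id_colored u) = u"
  and deg_id_colored [simp]: "deg (id_colored u) = length u"
  by (simp_all add: perm_def colors_def deg_def biword_id_colored del: upt_Suc)

text \<open>Ranks preserve the order of the letters, and the identity is the only increasing
  permutation.\<close>

lemma Std_eq_id_colored_iff:
  assumes "distinct_letters w"
  shows "Std w = id_colored u \<longleftrightarrow> sorted (map fst w) \<and> map snd w = u"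
proof -
  have p: "perm (Std w) = map (rank (letters w)) (map fst w)"
    using perm_Std[OF assms] std_eq_map_rank[OF assms] by simp
  have "perm (Std w) = [1..<Suc (length w)] \<longleftrightarrow> sorted (map fst w)"
  proof
    assume e: "perm (Std w) = [1..<Suc (length w)]"
    have "fst (w ! i) \<le> fst (w ! j)" if "i < j" "j < length w" for i j
    proof -
      have "perm (Std w) ! i < perm (Std w) ! j" using that unfolding e by (simp del: upt_Suc)
      then have "rank (letters w) (fst (w ! i)) < rank (letters w) (fst (w ! j))"
        unfolding p using that by simp
      then show ?thesis using that by (subst (asm) rank_less_iff) auto
    qed
    then show "sorted (map fst w)" by (simp add: sorted_iff_nth_mono_less)
  next
    assume s: "sorted (map fst w)"
    have "sorted (perm (Std w))"
      unfolding p sorted_iff_nth_mono_less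
    proof (intro allI impI)
      fix i j assume ij: "i < j" "j < length (map (rank (letters w)) (map fst w))"
      then have "fst (w ! i) < fst (w ! j)"
        using s assms by (auto simp: sorted_iff_nth_mono_less distinct_conv_nth less_le)
      then have "rank (letters w) (fst (w ! i)) < rank (letters w) (fst (w ! j))"
        using ij by (intro rank_strict_mono) auto
      then show "map (rank (letters w)) (map fst w) ! i \<le> map (rank (letters w)) (map fst w) ! j"
        using ij by simp
    qed
    moreover have "set (perm (Std w)) = {1..length w}" "distinct (perm (Std w))"
      using perm_in_permutations[of "Std w"] assms by (simp_all add: permutations_of_set_def)
    ultimately show "perm (Std w) = [1..<Suc (length w)]"
      using sorted_distinct_set_unique[of "perm (Std w)" "[1..<Suc (length w)]"]
      by (simp add: atLeastLessThanSuc_atLeastAtMost del: upt_Suc One_nat_def)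
  qed
  then show ?thesis
    using colors_Std[OF assms] perm_id_colored[of u] colors_id_colored[of u]
    by (metis colperm_eqI length_map)
qed

lemma wcoef_complete:
  assumes "distinct_letters w"
  shows "wcoef (complete_fn A) w = (if sorted (map fst w) \<and> mset (map snd w) = A then 1 else 0)"
proof -
  have "wcoef (complete_fn A :: ('a, 'b) fqsym) w =
      (\<Sum>u\<in>permutations_of_multiset A. if u = map snd w then (if sorted (map fst w) then 1 else 0) else 0)"
    unfolding complete_fn_def lookup_sum
    by (rule sum.cong[OF refl]) (use Std_eq_id_colored_iff[OF assms] in \<open>auto simp: G_def lookup_basis eq_commute\<close>)
  then show ?thesis
    by (simp only: sum.delta[OF finite_permutations_of_multiset])
      (auto simp: permutations_of_multiset_def)
qed

lemma sorted_shuffle: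
  assumes "distinct_letters (v @ w)"
  shows "{x \<in> shuffles v w. sorted (map fst x)} =
    (if sorted (map fst v) \<and> sorted (map fst w) then {sort_key fst (v @ w)} else {})"
proof -
  have disj: "set v \<inter> set w = {}" using assms by force
  have f: "filter (\<lambda>e. e \<in> set v) x = v" "filter (\<lambda>e. e \<notin> set v) x = w" if "x \<in> shuffles v w" for x
    using filter_shuffle[OF that, of "\<lambda>e. e \<in> set v"] disj by auto
  have inj: "inj_on fst (set v \<union> set w)" 
    using assms by (simp only: distinct_map set_append)
  \<comment> \<open>An increasing word with distinct letters is determined by its set of
    biletters.\<close>
  have uniq: "x = y" if "set x = set y" "distinct_letters x" "distinct_letters y"
      "sorted (map fst x)" "sorted (map fst y)" "set x \<subseteq> set v \<union> set w" for x y
    by (rule map_sorted_distinct_set_unique[of fst]) (use that inj_on_subset[OF inj] in auto)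
  have sorted: "sorted (map fst v) \<and> sorted (map fst w) \<and> x = sort_key fst (v @ w)"
    if x: "x \<in> shuffles v w" "sorted (map fst x)" for x
  proof (intro conjI)
    show "sorted (map fst v)" "sorted (map fst w)"
      using sorted_filter[OF x(2)] f[OF x(1)] by metis+
    show "x = sort_key fst (v @ w)"
      using set_shuffles[OF x(1)] distinct_letters_shuffles[OF x(1)] assms x(2)
      by (intro uniq) (simp_all add: distinct_map disj)
  qed
  have mem: "sort_key fst (v @ w) \<in> shuffles v w" if s: "sorted (map fst v)" "sorted (map fst w)"
  proof -
    define x where "x = sort_key fst (v @ w)"
    have x: "set x = set v \<union> set w" "sorted (map fst x)"
      by (simp_all add: x_def)
    have "mset (map fst x) = mset (map fst (v @ w))"
      by (simp add: x_def)
    then have d: "distinct_letters x" using assms by (metis mset_eq_imp_distinct_iff)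
    have "filter (\<lambda>e. e \<in> set v) x = v"
      by (rule uniq) (use x(1) d s assms in \<open>auto intro: sorted_filter[OF x(2)] distinct_map_filter\<close>)
    moreover have "filter (\<lambda>e. e \<notin> set v) x = w"
      by (rule uniq) (use x(1) d s assms disj in \<open>auto intro: sorted_filter[OF x(2)] distinct_map_filter\<close>)
    ultimately show ?thesis
      using partition_in_shuffles[of x "\<lambda>e. e \<in> set v"] unfolding x_def by metis
  qed
  show ?thesis
  proof (cases "sorted (map fst v) \<and> sorted (map fst w)")
    case True
    then have "{x \<in> shuffles v w. sorted (map fst x)} = {sort_key fst (v @ w)}"
    proof (intro equalityI subsetI)
      fix x assume "x \<in> {sort_key fst (v @ w)}"
      then show "x \<in> {x \<in> shuffles v w. sorted (map fst x)}"
        using mem True sorted_sort_key[of fst "v @ w"] by (simp only: singleton_iff mem_Collect_eq simp_thms)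
    qed (use sorted in blast)
    then show ?thesis using True by simp
  next
    case False
    then have "{x \<in> shuffles v w. sorted (map fst x)} = {}" using sorted by blast
    then show ?thesis using False by (simp only: if_False)
  qed
qed

text \<open>All shuffles have the same color content and at most one is increasing. The relative
  order of the letters of \<open>v\<close> and \<open>w\<close> has dropped out, which makes a
  splitting possible.\<close>

lemma shuffle_sum_complete:
  assumes "distinct_letters (v @ w)"
  shows "shuffle_sum (complete_fn A) v w = (if sorted (map fst v) \<and> sorted (map fst w)
    \<and> mset (map snd v) + mset (map snd w) = A then 1 else 0)"
proof -
  have "wcoef (complete_fn A :: ('a, 'b) fqsym) x = (if sorted (map fst x) then
      (if mset (map snd v) + mset (map snd w) = A then 1 else 0) else 0)" if "x \<in> shuffles v w" for x
    using wcoef_complete[of x A] distinct_letters_shuffles[OF that] assms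
      mset_shuffles[OF that]
    by (cases "sorted (map fst x)"; cases "mset (map snd v) + mset (map snd w) = A") simp_all
  then have "shuffle_sum (complete_fn A :: ('a, 'b) fqsym) v w =
      (\<Sum>x\<in>{x \<in> shuffles v w. sorted (map fst x)}.
        if mset (map snd v) + mset (map snd w) = A then 1 else 0)"
    unfolding shuffle_sum_def sum.inter_filter[OF finite_shuffles] by (intro sum.cong) auto
  then show ?thesis unfolding sorted_shuffle[OF assms] by simp
qed

section \<open>Splittings of complete functions and their propagation to \<open>Sym\<close>\<close>

lemma finite_submultisets: "finite {B. B \<subseteq># A}"
proof (rule finite_subset)
  show "{B. B \<subseteq># A} \<subseteq> mset ` {xs. set xs \<subseteq> set_mset A \<and> length xs \<le> size A}"
  proof
    fix B assume "B \<in> {B. B \<subseteq># A}"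
    moreover obtain xs where xs: "B = mset xs" using ex_mset by metis
    ultimately have sub: "mset xs \<subseteq># A" by simp
    have "set_mset (mset xs) \<subseteq> set_mset A" "size (mset xs) \<le> size A"
      by (rule set_mset_mono[OF sub]) (rule size_mset_mono[OF sub])
    then show "B \<in> mset ` {xs. set xs \<subseteq> set_mset A \<and> length xs \<le> size A}"
      using xs by (intro image_eqI[of _ _ xs]) simp_all
  qed
qed (simp add: finite_lists_length_le)

text \<open>The elements \<open>H\<close> whose shuffle sums over arbitrary pairs of words with disjoint letters
  (and not only over the shifted pairs that occur in the coproduct) are those of an element of
  \<open>Sym \<otimes> Sym\<close>.\<close>

definition Sym_splittable :: "('c, 'k::comm_ring_1) fqsym \<Rightarrow> bool" where
  "Sym_splittable H \<longleftrightarrow> (\<exists>L. set L \<subseteq> Sym \<times> Sym \<and> splitting L H)"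

lemma add_eq_iff_subseteq_mset: "M + N = A \<longleftrightarrow> M \<subseteq># A \<and> A - M = N"
  by (metis add_diff_cancel_left' mset_subset_eq_add_left subset_mset.add_diff_inverse)

lemma sum_list_mult_sum_list:
  "(\<Sum>x\<leftarrow>L. g x) * (\<Sum>y\<leftarrow>L'. k y) = (\<Sum>x\<leftarrow>L. \<Sum>y\<leftarrow>L'. g x * (k y :: 'k::comm_semiring_0))"
  by (induction L) (simp_all add: distrib_right sum_list_const_mult)

text \<open>The pairs are the complete functions of \<open>B\<close> and \<open>A - B\<close> for
  all submultisets \<open>B\<close> of \<open>A\<close>, as in the coproduct of complete symmetric
  functions. That both factors are complete again is used in
  \<open>Sym_star_complete_right\<close>.\<close>

lemma splitting_complete:
  "\<exists>L. set L \<subseteq> range complete_fn \<times> range complete_fn \<and>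
    splitting L (complete_fn A :: ('c, 'k::comm_ring_1) fqsym)"
proof -
  obtain Bs where Bs: "set Bs = {B. B \<subseteq># A}" "distinct Bs"
    using finite_distinct_list[OF finite_submultisets] by blast
  have "splitting (map (\<lambda>B. (complete_fn B, complete_fn (A - B))) Bs) (complete_fn A :: ('c, 'k) fqsym)"
    unfolding splitting_def
  proof (intro allI impI)
    fix v w :: "(nat \<times> 'c) list" assume d: "distinct_letters (v @ w)"
    let ?s = "sorted (map fst v) \<and> sorted (map fst w)" and ?M = "mset (map snd v)" and ?N = "mset (map snd w)"
    have "(\<Sum>(F, H)\<leftarrow>map (\<lambda>B. (complete_fn B, complete_fn (A - B))) Bs. wcoef F v * wcoef H w) =
        (\<Sum>B\<in>{B. B \<subseteq># A}. wcoef (complete_fn B) v * wcoef (complete_fn (A - B)) w :: 'k)"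
      using Bs by (simp add: o_def sum_list_distinct_conv_sum_set)
    \<comment> \<open>The factor \<open>complete_fn B\<close> tests the color content of
      \<open>v\<close>, so at most one \<open>B\<close> survives.\<close>
    also have "\<dots> = (\<Sum>B\<in>{B. B \<subseteq># A}. if B = ?M then (if ?s \<and> A - ?M = ?N then 1 else 0) else 0)"
      using d by (intro sum.cong refl) (auto simp: wcoef_complete)
    also have "\<dots> = (if ?s \<and> ?M + ?N = A then 1 else 0)"
      using add_eq_iff_subseteq_mset[of ?M ?N] by (subst sum.delta[OF finite_submultisets]) auto
    finally show "shuffle_sum (complete_fn A :: ('c, 'k) fqsym) v w =
       (\<Sum>(F, H)\<leftarrow>map (\<lambda>B. (complete_fn B, complete_fn (A - B))) Bs. wcoef F v * wcoef H w)"
      using shuffle_sum_complete[OF d, of A] by auto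
  qed
  moreover have "set (map (\<lambda>B. (complete_fn B, complete_fn (A - B))) Bs)
      \<subseteq> range complete_fn \<times> (range complete_fn :: ('c, 'k) fqsym set)"
    by auto
  ultimately show ?thesis by blast
qed

lemma Sym_splittable_complete: "Sym_splittable (complete_fn A)"
  using splitting_complete[of A] Sym_complete unfolding Sym_splittable_def by blast

text \<open>The shuffle sum of a product cuts both words; the cuts of \<open>v\<close> recombine to
  products of left factors, those of \<open>w\<close> to products of right factors.\<close>

lemma splitting_fq_mult:
  assumes "splitting L H" "splitting L' H'"
  shows "splitting (map (\<lambda>((A, B), (A', B')). (fq_mult A A', fq_mult B B')) (List.product L L'))
    (fq_mult H H')"
  unfolding splitting_def
proof (intro allI impI)
  fix v w :: "(nat \<times> 'a) list" assume d: "distinct_letters (v @ w)"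
  have dv: "distinct_letters v" and dw: "distinct_letters w" using d by auto
  have dt: "distinct_letters (take i v @ take j w)" and dd: "distinct_letters (drop i v @ drop j w)" for i j
    using d by (auto simp: distinct_letters_take distinct_letters_drop dest!: in_set_takeD in_set_dropD)
  have "shuffle_sum (fq_mult H H') v w = (\<Sum>i\<le>length v. \<Sum>j\<le>length w.
      (\<Sum>(A, B)\<leftarrow>L. wcoef A (take i v) * wcoef B (take j w)) *
      (\<Sum>(A', B')\<leftarrow>L'. wcoef A' (drop i v) * wcoef B' (drop j w)))"
    unfolding shuffle_sum_fq_mult[OF d] using assms dt dd by (simp add: splitting_def)
  also have "\<dots> = (\<Sum>(A, B)\<leftarrow>L. \<Sum>(A', B')\<leftarrow>L'. \<Sum>i\<le>length v. \<Sum>j\<le>length w.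
      (wcoef A (take i v) * wcoef A' (drop i v)) * (wcoef B (take j w) * wcoef B' (drop j w)))"
    unfolding sum_list_mult_sum_list case_prod_unfold sum_list_sum_commute by (simp only: mult_ac)
  also have "\<dots> = (\<Sum>(A, B)\<leftarrow>L. \<Sum>(A', B')\<leftarrow>L'. wcoef (fq_mult A A') v * wcoef (fq_mult B B') w)"
    unfolding wcoef_fq_mult[OF dv] wcoef_fq_mult[OF dw] sum_product ..
  also have "\<dots> = (\<Sum>(A, B)\<leftarrow>map (\<lambda>((A, B), (A', B')). (fq_mult A A', fq_mult B B')) (List.product L L').
      wcoef A v * wcoef B w)"
    by (induction L) (auto simp: o_def case_prod_unfold)
  finally show "shuffle_sum (fq_mult H H') v w =
    (\<Sum>(A, B)\<leftarrow>map (\<lambda>((A, B), (A', B')). (fq_mult A A', fq_mult B B')) (List.product L L').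
      wcoef A v * wcoef B w)" .
qed

lemma Sym_imp_splittable:
  assumes "F \<in> Sym"
  shows "Sym_splittable F"
  using assms
proof (induction rule: Sym_induct)
  case (S v)
  show ?case unfolding S_eq_complete by (rule Sym_splittable_complete)
next
  case zero
  have "splitting [] 0" by (simp add: splitting_def shuffle_sum_def)
  then show ?case unfolding Sym_splittable_def by (intro exI[of _ "[]"]) simp
next
  case (add F H)
  then obtain L L' where "set L \<subseteq> Sym \<times> Sym" "splitting L F" "set L' \<subseteq> Sym \<times> Sym" "splitting L' H"
    unfolding Sym_splittable_def by blast
  then show ?case unfolding Sym_splittable_def
    by (intro exI[of _ "L @ L'"]) (auto simp: splitting_def shuffle_sum_def lookup_add sum.distrib)
next
  case (scale a F)
  then obtain L where L: "set L \<subseteq> Sym \<times> Sym" "splitting L F"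
    unfolding Sym_splittable_def by blast
  have "splitting (map (\<lambda>(A, B). (scale a A, B)) L) (scale a F)"
    using L(2) by (simp add: splitting_def shuffle_sum_def sum_distrib_left[symmetric]
        sum_list_const_mult[symmetric] o_def case_prod_unfold mult.assoc)
  then show ?case unfolding Sym_splittable_def
    using L(1) by (intro exI[of _ "map (\<lambda>(A, B). (scale a A, B)) L"]) (auto simp: Sym_scale)
next
  case (mult F H)
  then obtain L L' where L: "set L \<subseteq> Sym \<times> Sym" "splitting L F" "set L' \<subseteq> Sym \<times> Sym" "splitting L' H"
    unfolding Sym_splittable_def by blast
  have "set (map (\<lambda>((A, B), (A', B')). (fq_mult A A', fq_mult B B')) (List.product L L')) \<subseteq> Sym \<times> Sym"
    using L(1,3) by (auto intro!: Sym_fq_mult)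
  then show ?case unfolding Sym_splittable_def using splitting_fq_mult[OF L(2,4)] by blast
qed

text \<open>Coproduct coefficients are shuffle sums at a biword and a shifted biword. The splitting
  identity applies to this pair, and the shift is invisible to \<open>Std\<close>.\<close>

lemma splitting_coproduct:
  assumes "splitting L H"
  shows "coproduct H = (\<Sum>(A, B)\<leftarrow>L. tensor_pair A B)"
proof (rule poly_mapping_eqI)
  fix xy :: "'a colperm \<times> 'a colperm"
  obtain x y where xy: "xy = (x, y)" by force
  show "coef (coproduct H) xy = coef (\<Sum>(A, B)\<leftarrow>L. tensor_pair A B) xy"
    using assms distinct_letters_append_shift[of x y]
    by (simp add: xy coef_coproduct splitting_def coef_sum_list case_prod_unfold lookup_tensor_pair Std_shift)
qed

section \<open>The operation \<open>*'\<close> on complete functions\<close>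

lemma wreath_mult_id_colored:
  assumes "length u = length u'"
  shows "wreath_mult f (id_colored u) (id_colored u') = id_colored (map2 f u u')"
proof -
  have "biword (wreath_mult f (id_colored u) (id_colored u')) = biword (id_colored (map2 f u u'))"
    unfolding biword_wreath_mult[of "id_colored u" "id_colored u'" f, simplified, OF assms]
    by (rule nth_equalityI)
      (auto simp: act_def biword_id_colored assms case_prod_unfold simp del: upt_Suc)
  then show ?thesis by (simp add: biword_inject)
qed

text \<open>These numbers become the structure constants of \<open>star\<close> on complete
  functions. The word \<open>u'\<close> comes first in \<open>map2\<close> because
  \<open>star\<close> reverses the wreath product.\<close>

definition pointwise_count :: "('c \<Rightarrow> 'c \<Rightarrow> 'c) \<Rightarrow> 'c multiset \<Rightarrow> 'c multiset \<Rightarrow> 'c list \<Rightarrow> nat" where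
  "pointwise_count f A B w = card {(u, u'). u \<in> permutations_of_multiset A \<and>
     u' \<in> permutations_of_multiset B \<and> map2 f u' u = w}"

lemma finite_pointwise:
  "finite {(u, u'). u \<in> permutations_of_multiset A \<and> u' \<in> permutations_of_multiset B \<and> P u u'}"
  by (rule finite_subset[of _ "permutations_of_multiset A \<times> permutations_of_multiset B"]) auto

text \<open>Rearranging both factors by a permutation that takes \<open>w\<close> to
  \<open>w'\<close> maps factorizations of \<open>w\<close> injectively to those of
  \<open>w'\<close>. Exchanging the words gives the reverse inequality.\<close>

lemma pointwise_count_mono:
  assumes "size A = size B" "mset w = mset w'"
  shows "pointwise_count f A B w \<le> pointwise_count f A B w'"
proof -
  obtain p where p: "p permutes {..<length w}" "permute_list p w = w'"
    using mset_eq_permutation[OF assms(2)[symmetric]] by blast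
  let ?P = "\<lambda>w. {(u, u'). u \<in> permutations_of_multiset A \<and>
     u' \<in> permutations_of_multiset B \<and> map2 f u' u = w}"
  \<comment> \<open>Equal sizes of \<open>A\<close> and \<open>B\<close> keep \<open>map2\<close>
    from truncating.\<close>
  have len: "length u = length w" "length u' = length w"
    if uu: "u \<in> permutations_of_multiset A" "u' \<in> permutations_of_multiset B" "w = map2 f u' u" for u u'
  proof -
    have "length u = size A" "length u' = size A"
      using permutations_of_multisetD[OF uu(1)] permutations_of_multisetD[OF uu(2)] assms(1) by auto
    moreover from this have "length w = size A" unfolding uu(3) by simp
    ultimately show "length u = length w" "length u' = length w" by simp_all
  qed
  have "card (?P w) \<le> card (?P w')"
  proof (rule card_inj_on_le[where f = "\<lambda>(u, u'). (permute_list p u, permute_list p u')"])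
    show "(\<lambda>(u, u'). (permute_list p u, permute_list p u')) ` ?P w \<subseteq> ?P w'"
    proof clarify
      fix u u' assume uu: "u \<in> permutations_of_multiset A" "u' \<in> permutations_of_multiset B"
        "w = map2 f u' u"
      have l: "length u = length w" "length u' = length w" using len[OF uu] .
      have p': "p permutes {..<length u'}" using p(1) l by simp
      have "map2 f (permute_list p u') (permute_list p u) = permute_list p (map2 f u' u)"
        using permute_list_map[of p "zip u' u" "case_prod f"] permute_list_zip[OF p' refl, of u] p(1) l
        by simp
      then have "map2 f (permute_list p u') (permute_list p u) = w'"
        unfolding uu(3)[symmetric] p(2) .
      moreover have "mset (permute_list p u) = mset u" "mset (permute_list p u') = mset u'"
        using p(1) l by (intro mset_permute_list; simp)+
      ultimately show "permute_list p u \<in> permutations_of_multiset A \<and>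
          permute_list p u' \<in> permutations_of_multiset B \<and>
          map2 f (permute_list p u') (permute_list p u) = w'"
        using uu(1,2) unfolding permutations_of_multiset_def by blast
    qed
    have inj: "u = v" if "length u = length w" "length v = length w" "permute_list p u = permute_list p v"
      for u v :: "'a list"
    proof (rule nth_equalityI)
      fix i assume "i < length u"
      then have i: "i < length w" using that by simp
      have b: "bij_betw p {..<length w} {..<length w}" using p(1) by (rule permutes_imp_bij)
      obtain j where "j < length w" "p j = i"
        using bij_betw_imp_surj_on[OF b] i by (metis imageE lessThan_iff)
      then show "u ! i = v ! i"
        using that permute_list_nth[of p u j] permute_list_nth[of p v j] p(1) by simp
    qed (use that in simp)
    show "inj_on (\<lambda>(u, u'). (permute_list p u, permute_list p u')) (?P w)"
    proof (rule inj_onI, clarify)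
      fix u u' v v'
      assume u: "u \<in> permutations_of_multiset A" "u' \<in> permutations_of_multiset B" "w = map2 f u' u"
        and v: "v \<in> permutations_of_multiset A" "v' \<in> permutations_of_multiset B" "map2 f v' v = map2 f u' u"
        and e: "permute_list p u = permute_list p v" "permute_list p u' = permute_list p v'"
      then have "w = map2 f v' v" by simp
      then show "u = v \<and> u' = v'" using inj e len[OF u] len[OF v(1,2)] by blast
    qed
  qed (rule finite_pointwise)
  then show ?thesis by (simp add: pointwise_count_def)
qed

lemma pointwise_count_cong:
  assumes "size A = size B" "mset w = mset w'"
  shows "pointwise_count f A B w = pointwise_count f A B w'"
  using pointwise_count_mono[OF assms] pointwise_count_mono[OF assms(1) assms(2)[symmetric]]
  by (rule antisym)

section \<open>Products of complete functions under \<open>star\<close>\<close>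

lemma coef_G: "coef (G g) h = (if g = h then 1 else 0)"
  by (simp add: G_def lookup_basis)

lemma star_G_G: "star f (G g) (G h) = star_basis f g h"
  by (simp add: star_def G_def)

lemma star_G_id_colored:
  "star f (G (id_colored u)) (G (id_colored u')) =
    (if length u = length u' then G (id_colored (map2 f u' u)) else 0)"
  by (simp add: star_G_G star_basis_def wreath_mult_id_colored)

lemma star_complete:
  "star f (complete_fn A) (complete_fn B) = (\<Sum>u\<in>permutations_of_multiset A.
    \<Sum>u'\<in>permutations_of_multiset B. star f (G (id_colored u)) (G (id_colored u')))"
  unfolding complete_fn_def
  by (subst linear_map_sum[OF linear_map_star_left]) (simp only: linear_map_sum[OF linear_map_star_right])

lemma star_complete_size_neq:
  assumes "size A \<noteq> size B"
  shows "star f (complete_fn A) (complete_fn B) = 0"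
proof -
  have "length u \<noteq> length u'" if "u \<in> permutations_of_multiset A" "u' \<in> permutations_of_multiset B" for u u'
    using that assms by (auto simp: permutations_of_multiset_def)
  then show ?thesis unfolding star_complete star_G_id_colored by (auto intro!: sum.neutral)
qed

text \<open>By \<open>pointwise_count_cong\<close> the choice of the representative \<open>w\<close> of \<open>M\<close> is immaterial.\<close>

lemma star_complete_size_eq:
  fixes Ms :: "'c multiset set"
  assumes size: "size A = size B" and fin: "finite Ms"
    and Ms: "\<And>u u'. mset u = A \<Longrightarrow> mset u' = B \<Longrightarrow> mset (map2 f u' u) \<in> Ms"
  shows "star f (complete_fn A) (complete_fn B) = (\<Sum>M\<in>Ms. scale (of_nat (pointwise_count f A B (SOME w. mset w = M)))
     (complete_fn M :: ('c, 'k::comm_ring_1) fqsym))"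
proof (rule fqsym_eqI)
  fix w :: "(nat \<times> 'c) list" assume w: "distinct_letters w"
  let ?w = "map snd w" and ?P = "{(u, u'). u \<in> permutations_of_multiset A \<and>
     u' \<in> permutations_of_multiset B \<and> map2 f u' u = map snd w}"
  have l: "length u = length u'" if "u \<in> permutations_of_multiset A" "u' \<in> permutations_of_multiset B" for u u'
    using that size by (metis permutations_of_multisetD size_mset)
  have "wcoef (star f (complete_fn A) (complete_fn B) :: ('c, 'k) fqsym) w = (\<Sum>(u, u')\<in>permutations_of_multiset A \<times> permutations_of_multiset B.
      if map2 f u' u = ?w then (if sorted (map fst w) then 1 else 0) else 0)"
    unfolding star_complete lookup_sum sum.cartesian_product
    by (rule sum.cong[OF refl])
      (auto simp: l star_G_id_colored coef_G Std_eq_id_colored_iff[OF w] eq_commute[of _ "Std w"])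
  also have "\<dots> = (\<Sum>z\<in>?P. if sorted (map fst w) then 1 else 0)"
  proof -
    have "?P = {z \<in> permutations_of_multiset A \<times> permutations_of_multiset B.
        map2 f (snd z) (fst z) = ?w}" by auto
    then show ?thesis by (simp only: case_prod_unfold sum.inter_filter finite_SigmaI finite_permutations_of_multiset)
  qed
  also have "\<dots> = (if sorted (map fst w) then of_nat (pointwise_count f A B ?w) else 0)"
    by (simp add: pointwise_count_def)
  finally have lhs: "wcoef (star f (complete_fn A) (complete_fn B) :: ('c, 'k) fqsym) w =
      (if sorted (map fst w) then of_nat (pointwise_count f A B ?w) else 0)" .
  have cong: "pointwise_count f A B (SOME u. mset u = mset ?w) = pointwise_count f A B ?w"
    by (rule pointwise_count_cong[OF size]) (rule someI_ex[OF ex_mset])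
  have "wcoef (\<Sum>M\<in>Ms. scale (of_nat (pointwise_count f A B (SOME w. mset w = M)))
     (complete_fn M :: ('c, 'k) fqsym)) w = (\<Sum>M\<in>Ms. if M = mset ?w then
       (if sorted (map fst w) then of_nat (pointwise_count f A B ?w) else 0) else 0)"
    unfolding lookup_sum lookup_scale wcoef_complete[OF w]
    by (rule sum.cong[OF refl]) (auto simp: cong[simplified])
  also have "\<dots> = (if sorted (map fst w) then of_nat (pointwise_count f A B ?w) else 0)"
  \<comment> \<open>A content outside \<open>Ms\<close> is not attained by any pointwise product of
    the color words, so its count is 0.\<close>
  proof (cases "mset ?w \<in> Ms")
    case False
    have "map2 f u' u \<noteq> ?w" if "u \<in> permutations_of_multiset A" "u' \<in> permutations_of_multiset B" for u u'
      using Ms[OF permutations_of_multisetD[OF that(1)] permutations_of_multisetD[OF that(2)]] False by metis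
    then have "?P = {}" by blast
    then have "pointwise_count f A B ?w = 0" unfolding pointwise_count_def by (simp only: card.empty)
    then show ?thesis using False fin by (simp add: sum.delta)
  qed (use fin in \<open>simp add: sum.delta\<close>)
  finally show "wcoef (star f (complete_fn A) (complete_fn B)) w = wcoef (\<Sum>M\<in>Ms. scale (of_nat
      (pointwise_count f A B (SOME w. mset w = M))) (complete_fn M :: ('c, 'k) fqsym)) w"
    using lhs by simp
qed

lemma Sym_star_complete_complete: "star f (complete_fn A) (complete_fn B) \<in> Sym"
proof (cases "size A = size B")
  case True
  let ?Ms = "(\<lambda>(u, u'). mset (map2 f u' u)) ` (permutations_of_multiset A \<times> permutations_of_multiset B)"
  have "mset (map2 f u' u) \<in> ?Ms" if "mset u = A" "mset u' = B" for u u'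
    using that by (auto simp: permutations_of_multiset_def)
  moreover have "finite ?Ms" by simp
  ultimately show ?thesis
    by (subst star_complete_size_eq[OF True, of ?Ms]) (auto intro!: Sym_sum Sym_scale Sym_complete)
next
  case False
  then show ?thesis by (simp add: star_complete_size_neq Sym_zero)
qed

text \<open>Permuting the places of \<open>u\<close> by \<open>h\<close> does not change its content, and this is the only
  difference between the two products.\<close>

lemma star_complete_commute:
  assumes comm: "\<And>a b. f a b = f b a"
  shows "star f (complete_fn A) F = star f F (complete_fn A)"
proof (rule linear_map_eqI[OF linear_map_star_right linear_map_star_left])
  fix h
  show "star f (complete_fn A) (basis h) = star f (basis h) (complete_fn A :: ('a, 'b) fqsym)"
    unfolding G_def[symmetric]
  proof (cases "deg h = size A")
    case False
    then have len: "length u \<noteq> deg h" if "u \<in> permutations_of_multiset A" for u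
      using permutations_of_multisetD[OF that] by auto
    have "star f (complete_fn A) (G h) = (0 :: ('a, 'b) fqsym)"
      unfolding complete_fn_def linear_map_sum[OF linear_map_star_left]
      by (rule sum.neutral) (simp add: star_G_G star_basis_def len)
    moreover have "star f (G h) (complete_fn A) = (0 :: ('a, 'b) fqsym)"
      unfolding complete_fn_def linear_map_sum[OF linear_map_star_right]
      by (rule sum.neutral) (simp add: star_G_G star_basis_def len[THEN not_sym])
    ultimately show "star f (complete_fn A) (G h) = star f (G h) (complete_fn A :: ('a, 'b) fqsym)" by simp
  next
    case True
    let ?n = "deg h"
    have "perm h \<in> permutations_of_set {1..?n}" by (rule perm_in_permutations)
    then have ph: "set (perm h) = {1..?n}" "distinct (perm h)" by (auto simp: permutations_of_set_def)
    \<comment> \<open>The permutation of \<open>h\<close> on places counted from 0, extended by the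
      identity as \<open>permutes\<close> requires.\<close>
    define r where "r i = (if i < ?n then perm h ! i - 1 else i)" for i
    have inj: "inj_on r {..<?n}"
    proof (rule inj_onI)
      fix i j assume ij: "i \<in> {..<?n}" "j \<in> {..<?n}" "r i = r j"
      have "perm h ! i \<in> {1..?n}" "perm h ! j \<in> {1..?n}" using ph(1) ij nth_mem perm_length by (metis lessThan_iff)+
      then have "perm h ! i = perm h ! j" using ij by (auto simp: r_def)
      then show "i = j" using ij ph(2) by (simp add: nth_eq_iff_index_eq)
    qed
    have "r permutes {..<?n}"
    proof (rule bij_imp_permutes)
      have "r i < ?n" if "i < ?n" for i
      proof -
        have "perm h ! i \<in> {1..?n}" using ph(1) that nth_mem perm_length by metis
        then show ?thesis using that by (auto simp: r_def)
      qed
      then have "r ` {..<?n} = {..<?n}" using inj by (intro endo_inj_surj) auto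
      then show "bij_betw r {..<?n} {..<?n}" using inj by (simp add: bij_betw_def)
    qed (auto simp: r_def)
    note r = this
    let ?P = "permutations_of_multiset A"
    have len: "length u = ?n" if "u \<in> ?P" for u
      using that True by (auto simp: permutations_of_multiset_def)
    \<comment> \<open>Moving \<open>u\<close> from the left of \<open>h\<close> to the right
      permutes its entries by \<open>h\<close>; the colors are then multiplied in the opposite
      order, which commutativity repairs.\<close>
    have mult: "wreath_mult f (id_colored u) h = wreath_mult f h (id_colored (permute_list r u))"
      if "u \<in> ?P" for u
    proof -
      note l = len[OF that]
      have "biword (wreath_mult f (id_colored u) h) = biword (wreath_mult f h (id_colored (permute_list r u)))"
        unfolding biword_wreath_mult[of "id_colored u" h f, simplified, OF l]
          biword_wreath_mult[of h "id_colored (permute_list r u)" f, simplified, OF l[symmetric]]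
      proof (rule nth_equalityI)
        show "length (act f (biword (id_colored u)) (biword h)) =
            length (act f (biword h) (biword (id_colored (permute_list r u))))" by (simp add: l)
      next
        fix i assume "i < length (act f (biword (id_colored u)) (biword h))"
        then have i: "i < ?n" by simp
        have b: "fst (biword h ! i) = perm h ! i" using i by (simp add: perm_def)
        have "perm h ! i \<in> {1..?n}" using ph(1) i nth_mem perm_length by metis
        then have "1 \<le> perm h ! i" "perm h ! i - 1 < ?n" by auto
        moreover have "permute_list r u ! i = u ! (perm h ! i - 1)"
          using permute_list_nth[of r u i] r l i by (simp add: r_def)
        moreover have "biword (id_colored u) ! j = (Suc j, u ! j)" if "j < ?n" for j
          using that l by (simp add: biword_id_colored del: upt_Suc)
        moreover have "biword (id_colored (permute_list r u)) ! i = (Suc i, permute_list r u ! i)"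
          using i l by (simp add: biword_id_colored del: upt_Suc)
        ultimately show "act f (biword (id_colored u)) (biword h) ! i =
            act f (biword h) (biword (id_colored (permute_list r u))) ! i"
          using i l b by (simp add: act_def case_prod_unfold comm[of "snd (biword h ! i)"])
      qed
      then show ?thesis by (simp add: biword_inject)
    qed
    have bij: "bij_betw (permute_list r) ?P ?P"
    proof -
      have "inj_on (permute_list r) ?P"
      proof (rule inj_onI)
        fix u v assume uv: "u \<in> ?P" "v \<in> ?P" "permute_list r u = permute_list r v"
        show "u = v"
        proof (rule nth_equalityI)
          fix i assume "i < length u"
          then have "i < ?n" using len uv(1) by simp
          then obtain j where j: "j < ?n" "r j = i"
            using permutes_image[OF r] by (metis imageE lessThan_iff)
          then show "u ! i = v ! i"
            using uv len permute_list_nth[of r u j] permute_list_nth[of r v j] r by simp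
        qed (use uv len in simp)
      qed
      moreover have "permute_list r ` ?P \<subseteq> ?P"
        using len r by (auto simp: permutations_of_multiset_def)
      ultimately show ?thesis
        by (simp add: bij_betw_def endo_inj_surj)
    qed
    have "star f (G h) (complete_fn A :: ('a, 'b) fqsym) = (\<Sum>u\<in>?P. G (wreath_mult f (id_colored u) h))"
      unfolding complete_fn_def linear_map_sum[OF linear_map_star_right]
      by (rule sum.cong) (simp_all add: star_G_G star_basis_def len)
    also have "\<dots> = (\<Sum>u\<in>?P. G (wreath_mult f h (id_colored (permute_list r u))))"
      by (rule sum.cong) (simp_all add: mult)
    also have "\<dots> = (\<Sum>u\<in>?P. G (wreath_mult f h (id_colored u)))"
      by (rule sum.reindex_bij_betw[OF bij])
    also have "\<dots> = star f (complete_fn A) (G h)"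
      unfolding complete_fn_def linear_map_sum[OF linear_map_star_left]
      by (rule sum.cong) (simp_all add: star_G_G star_basis_def len)
    finally show "star f (complete_fn A) (G h) = star f (G h) (complete_fn A :: ('a, 'b) fqsym)" ..
  qed
qed

text \<open>For a product, the splitting of \<open>complete_fn A\<close> consists of complete
  functions again, so the induction hypothesis, stated for all \<open>A\<close>, applies to each
  factor.\<close>

lemma Sym_star_complete_right: "F \<in> Sym \<Longrightarrow> star f F (complete_fn A) \<in> Sym"
proof (induction arbitrary: A rule: Sym_induct)
  case (mult F H)
  obtain L where "set L \<subseteq> range complete_fn \<times> range complete_fn" "splitting L (complete_fn A :: ('a, 'b) fqsym)"
    using splitting_complete by blast
  then show ?case
    using mult by (auto simp: star_fq_mult case_prod_unfold intro!: Sym_sum_list Sym_fq_mult)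
qed (simp_all add: S_eq_complete Sym_star_complete_complete linear_map_zero[OF linear_map_star_left]
    linear_map_add[OF linear_map_star_left] linear_map_scale[OF linear_map_star_left]
    Sym_zero Sym_add Sym_scale)

text \<open>Splitting \<open>H\<close> reduces the left argument to a single complete function,
  which commutativity moves to the right, where \<open>Sym_star_complete_right\<close> takes
  over.\<close>

lemma Sym_star:
  assumes comm: "\<And>a b. f a b = f b a" and "F \<in> Sym" "H \<in> Sym"
  shows "star f F H \<in> Sym"
  using assms(2,3)
proof (induction arbitrary: H rule: Sym_induct)
  case (S v)
  then show ?case
    unfolding S_eq_complete star_complete_commute[of f, OF comm] by (intro Sym_star_complete_right)
next
  case (mult F F')
  obtain L where "set L \<subseteq> Sym \<times> Sym" "splitting L H"
    using Sym_imp_splittable[OF mult.prems] unfolding Sym_splittable_def by blast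
  then show ?case
    using mult.IH by (auto simp: star_fq_mult case_prod_unfold intro!: Sym_sum_list Sym_fq_mult)
qed (simp_all add: linear_map_zero[OF linear_map_star_left] linear_map_add[OF linear_map_star_left]
    linear_map_scale[OF linear_map_star_left] Sym_zero Sym_add Sym_scale)

lemma star_degree:
  fixes F H :: "('c, 'k::comm_ring_1) fqsym"
  assumes "\<forall>h\<in>supp F. deg h = n"
  shows "\<forall>h\<in>supp (star f F H). deg h = n"
proof (rule ballI, rule ccontr)
  fix g assume g: "g \<in> supp (star f F H)" "deg g \<noteq> n"
  have "coef (star_basis f x y :: ('c, 'k) fqsym) g = 0" if "x \<in> supp F" for x y
    using assms that g(2) deg_wreath_mult[of y x f] by (auto simp: star_basis_def coef_G)
  then have "coef (star f F H) g = 0"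
    unfolding star_def lookup_bilin_ext[OF finite_keys order_refl finite_keys order_refl]
    by (intro sum.neutral ballI) simp
  then show False using g(1) by (simp add: in_keys_iff)
qed

lemma subalgebra_Sym_deg:
  assumes comm: "\<And>a b. f a b = f b a"
  shows "is_subalgebra (star f) (Sym_deg n)"
  unfolding is_subalgebra_def
proof (intro conjI ballI allI)
  show "0 \<in> Sym_deg n" by (simp add: Sym_deg_def Sym_zero)
  show "F + H \<in> Sym_deg n" if "F \<in> Sym_deg n" "H \<in> Sym_deg n" for F H
    using that Sym_add keys_add[of F H] by (auto simp: Sym_deg_def)
  show "scale a F \<in> Sym_deg n" if "F \<in> Sym_deg n" for a F
    using that Sym_scale by (auto simp: Sym_deg_def in_keys_iff)
  show "star f F H \<in> Sym_deg n" if "F \<in> Sym_deg n" "H \<in> Sym_deg n" for F H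
    using that Sym_star[of f F H, OF comm] star_degree[of F n f H] unfolding Sym_deg_def by blast
qed

section \<open>Splitting over several factors\<close>

text \<open>Linearity in the left pair of arguments and then in the right one reduces to basis
  lists; there, unequal lengths of \<open>hs\<close> and \<open>ks\<close> make both sides
  0.\<close>

lemma star_tensor_Cons:
  "star_tensor f (tensor_Cons F T) (tensor_Cons A U) = tensor_Cons (star f F A) (star_tensor f T U)"
proof (rule bilinear_eqI[where F = F and H = T])
  show "star_tensor f (tensor_Cons (basis h) (basis hs)) (tensor_Cons A U)
      = tensor_Cons (star f (basis h) A) (star_tensor f (basis hs) U)" for h hs
  proof (rule bilinear_eqI[where F = A and H = U])
    show "star_tensor f (tensor_Cons (basis h) (basis hs)) (tensor_Cons (basis k) (basis ks))
      = tensor_Cons (star f (basis h) (basis k)) (star_tensor f (basis hs) (basis ks))" for k ks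
      by (auto simp: star_tensor_def star_def linear_map_zero[OF linear_map_bilin_ext_right])
  qed (intro linear_map_comp[OF linear_map_star_tensor_right] linear_map_bilin_ext
      linear_map_bilin_ext_left linear_map_bilin_ext_right
      linear_map_star_right linear_map_star_tensor_right)+
qed (intro linear_map_comp[OF linear_map_star_tensor_left] linear_map_bilin_ext
      linear_map_bilin_ext_left linear_map_bilin_ext_right
      linear_map_star_left linear_map_star_tensor_left)+

lemma star_tensor_tensor:
  "length Fs = length As \<Longrightarrow>
    star_tensor f (tensor Fs) (tensor As) = tensor (map2 (star f) Fs As)"
proof (induction Fs As rule: list_induct2)
  case Nil
  show ?case by (simp add: star_tensor_def)
next
  case (Cons F Fs A As)
  then show ?case by (simp add: star_tensor_Cons)
qed

lemma mu_tensor: "mu (tensor Fs) = fq_prod Fs"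
proof (induction Fs)
  case Nil
  show ?case by (simp add: mu_def fq_prod_def)
next
  case (Cons F Fs)
  have "mu (tensor_Cons F T) = fq_mult F (mu T)" for T
  proof (rule bilinear_eqI[where F = F and H = T])
    show "mu (tensor_Cons (basis h) (basis hs)) = fq_mult (basis h) (mu (basis hs))" for h hs
      by (simp add: mu_def fq_prod_def G_def)
  qed (intro linear_map_comp[OF linear_map_mu] linear_map_bilin_ext_left linear_map_bilin_ext_right
      linear_map_fq_mult_left linear_map_comp[OF linear_map_fq_mult_right] linear_map_mu)+
  then show ?case using Cons by (simp add: fq_prod_def)
qed

text \<open>The map applied here is the recursion step of \<open>iter_coproduct\<close>. On a pure
  tensor it replaces the first factor by its coproduct, which a splitting writes as a sum of pure
  tensors.\<close>

lemma coproduct_on_head: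
  fixes A :: "('c, 'k::comm_ring_1) fqsym"
  assumes "splitting L A"
  shows "lin_ext (\<lambda>hs. lin_ext (\<lambda>(h', h''). basis (h' # h'' # tl hs)) (coproduct (G (hd hs))))
      (tensor (A # As)) = (\<Sum>(B, C)\<leftarrow>L. tensor (B # C # As))"
proof -
  let ?\<Psi> = "lin_ext (\<lambda>hs. lin_ext (\<lambda>(h', h''). basis (h' # h'' # tl hs)) (coproduct (G (hd hs))))"
  \<comment> \<open>Puts a pair of colored permutations in front of \<open>T\<close>, so that the
    tail of the tensor becomes a parameter.\<close>
  let ?\<Phi> = "\<lambda>(T :: ('c, 'k) fq_tensor) (h', h''). tensor_Cons (basis h') (tensor_Cons (basis h'') T)"
  have lin: "linear_map (\<lambda>T. ?\<Phi> T p)" for p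
    unfolding case_prod_unfold by (intro linear_map_bilin_ext linear_map_bilin_ext_right)
  have "?\<Psi> (tensor_Cons A T) = lin_ext (?\<Phi> T) (coproduct A)" for T
  proof (rule bilinear_eqI[where F = A and H = T])
    show "?\<Psi> (tensor_Cons (basis h) (basis hs)) = lin_ext (?\<Phi> (basis hs)) (coproduct (basis h))" for h hs
      by (simp add: G_def case_prod_unfold)
  qed (intro linear_map_comp[OF linear_map_lin_ext] linear_map_bilin_ext_left linear_map_bilin_ext_right
      linear_map_coproduct linear_map_lin_ext_fun lin)+
  moreover have "lin_ext (?\<Phi> T) (tensor_pair B C) = tensor_Cons B (tensor_Cons C T)" for T B C
  proof (rule bilinear_eqI[where F = B and H = C])
    show "lin_ext (?\<Phi> T) (tensor_pair (basis x) (basis y)) = tensor_Cons (basis x) (tensor_Cons (basis y) T)" for x y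
      by simp
  qed (intro linear_map_comp[OF linear_map_lin_ext] linear_map_bilin_ext_left linear_map_bilin_ext_right
      linear_map_bilin_ext)+
  ultimately show ?thesis
    by (simp add: splitting_coproduct[OF assms] linear_map_sum_list[OF linear_map_lin_ext] case_prod_unfold)
qed

lemma sum_list_concat_map: "(\<Sum>x\<leftarrow>concat (map g L). k x) = (\<Sum>y\<leftarrow>L. \<Sum>x\<leftarrow>g y. k x)"
  by (induction L) auto

text \<open>One list \<open>L\<close> has to represent the iterated coproduct and to split
  \<open>star\<close> at the same time, hence the joint induction. The factors stay in
  \<open>Sym\<close> so that the first one can be split again in the next step.\<close>

lemma iter_coproduct_splitting:
  assumes "H \<in> Sym"
  shows "\<exists>L. (\<forall>As\<in>set L. length As = Suc r \<and> set As \<subseteq> Sym) \<and>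
    iter_coproduct (Suc r) H = (\<Sum>As\<leftarrow>L. tensor As) \<and>
    (\<forall>Fs. length Fs = Suc r \<longrightarrow>
      star f (fq_prod Fs) H = (\<Sum>As\<leftarrow>L. fq_prod (map2 (star f) Fs As)))"
proof (induction r)
  case 0
  have "iter_coproduct (Suc 0) H = tensor [H]"
    by (simp add: bilin_ext_def)
  moreover have "star f (fq_prod Fs) H = fq_prod (map2 (star f) Fs [H])" if "length Fs = Suc 0" for Fs
    using that by (cases Fs) (auto simp: fq_prod_def)
  ultimately show ?case
    using assms by (intro exI[of _ "[[H]]"]) simp
next
  case (Suc r)
  then obtain L where L: "\<And>As. As \<in> set L \<Longrightarrow> length As = Suc r \<and> set As \<subseteq> Sym"
    "iter_coproduct (Suc r) H = (\<Sum>As\<leftarrow>L. tensor As)"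
    "\<And>Fs. length Fs = Suc r \<Longrightarrow> star f (fq_prod Fs) H = (\<Sum>As\<leftarrow>L. fq_prod (map2 (star f) Fs As))"
    by blast
  \<comment> \<open>Choosing one splitting \<open>D A\<close> for each \<open>A\<close> lets the
    coproduct and the product formula use the same one.\<close>
  have "\<forall>A. \<exists>D. A \<in> Sym \<longrightarrow> set D \<subseteq> Sym \<times> Sym \<and> splitting D (A :: ('a, 'b) fqsym)"
    using Sym_imp_splittable unfolding Sym_splittable_def by blast
  then obtain D where D: "\<And>A. A \<in> Sym \<Longrightarrow> set (D A) \<subseteq> Sym \<times> Sym"
    "\<And>A. A \<in> Sym \<Longrightarrow> splitting (D A) (A :: ('a, 'b) fqsym)"
    by metis
  define L' where "L' = concat (map (\<lambda>As. map (\<lambda>(B, C). B # C # tl As) (D (hd As))) L)"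
  have hd: "hd As \<in> Sym" "As = hd As # tl As" "set (tl As) \<subseteq> Sym" if "As \<in> set L" for As
    using L(1)[OF that] by (cases As; auto)+
  have "\<forall>As\<in>set L'. length As = Suc (Suc r) \<and> set As \<subseteq> Sym"
  proof
    fix Bs assume "Bs \<in> set L'"
    then obtain As B C where As: "As \<in> set L" "(B, C) \<in> set (D (hd As))" "Bs = B # C # tl As"
      by (auto simp: L'_def)
    then show "length Bs = Suc (Suc r) \<and> set Bs \<subseteq> Sym"
      using D(1)[OF hd(1)[OF As(1)]] hd(3)[OF As(1)] L(1)[OF As(1)] by auto
  qed
  moreover have "iter_coproduct (Suc (Suc r)) H = (\<Sum>As\<leftarrow>L'. tensor As)"
  proof -
    let ?\<Psi> = "lin_ext (\<lambda>hs. lin_ext (\<lambda>(h', h''). basis (h' # h'' # tl hs)) (coproduct (G (hd hs))))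
      :: ('a, 'b) fq_tensor \<Rightarrow> ('a, 'b) fq_tensor"
    have "?\<Psi> (tensor As) = (\<Sum>(B, C)\<leftarrow>D (hd As). tensor (B # C # tl As))" if "As \<in> set L" for As
      using coproduct_on_head[OF D(2)[OF hd(1)[OF that]], of "tl As"] hd(2)[OF that] by metis
    then have "?\<Psi> (\<Sum>As\<leftarrow>L. tensor As) = (\<Sum>As\<leftarrow>L. \<Sum>(B, C)\<leftarrow>D (hd As). tensor (B # C # tl As))"
      unfolding linear_map_sum_list[OF linear_map_lin_ext]
      by (intro arg_cong[where f = sum_list] map_cong refl)
    then show ?thesis
      by (simp only: iter_coproduct.simps(3) L(2) L'_def sum_list_concat_map map_map o_def case_prod_unfold)
  qed
  moreover have "star f (fq_prod Fs) H = (\<Sum>As\<leftarrow>L'. fq_prod (map2 (star f) Fs As))"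
    if len: "length Fs = Suc (Suc r)" for Fs
  proof -
    obtain F1 Gs where Gs: "Fs = F1 # Gs" "length Gs = Suc r"
      using len by (cases Fs) auto
    obtain F2 Fs' where "Gs = F2 # Fs'" "length Fs' = r"
      using Gs(2) by (cases Gs) auto
    with Gs(1) have Fs: "Fs = F1 # F2 # Fs'" "length Fs' = r" by simp_all
    \<comment> \<open>Merging the first two factors leaves \<open>Suc r\<close> factors, the case of
      the induction hypothesis; the merged factor meets the head of \<open>As\<close>, which is then
      split.\<close>
    have "fq_prod Fs = fq_prod (fq_mult F1 F2 # Fs')"
      by (simp add: Fs(1) fq_prod_def fq_mult_assoc)
    then have "star f (fq_prod Fs) H = (\<Sum>As\<leftarrow>L. fq_prod (map2 (star f) (fq_mult F1 F2 # Fs') As))"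
      using L(3)[of "fq_mult F1 F2 # Fs'"] Fs(2) by simp
    also have "\<dots> = (\<Sum>As\<leftarrow>L. \<Sum>(B, C)\<leftarrow>D (hd As). fq_prod (map2 (star f) Fs (B # C # tl As)))"
    proof (intro arg_cong[where f = sum_list] map_cong refl)
      fix As assume As: "As \<in> set L"
      have "fq_prod (map2 (star f) (fq_mult F1 F2 # Fs') As) =
          fq_mult (star f (fq_mult F1 F2) (hd As)) (fq_prod (map2 (star f) Fs' (tl As)))"
        by (subst hd(2)[OF As]) (simp add: fq_prod_def)
      also have "\<dots> = (\<Sum>(B, C)\<leftarrow>D (hd As). fq_mult (fq_mult (star f F1 B) (star f F2 C)) (fq_prod (map2 (star f) Fs' (tl As))))"
        unfolding star_fq_mult[OF D(2)[OF hd(1)[OF As]]] linear_map_sum_list[OF linear_map_fq_mult_left]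
          case_prod_unfold ..
      also have "\<dots> = (\<Sum>(B, C)\<leftarrow>D (hd As). fq_prod (map2 (star f) Fs (B # C # tl As)))"
        by (simp add: Fs(1) fq_prod_def fq_mult_assoc)
      finally show "fq_prod (map2 (star f) (fq_mult F1 F2 # Fs') As)
          = (\<Sum>(B, C)\<leftarrow>D (hd As). fq_prod (map2 (star f) Fs (B # C # tl As)))" .
    qed
    finally show ?thesis
      by (simp only: L'_def sum_list_concat_map map_map o_def case_prod_unfold)
  qed
  ultimately show ?case by (intro exI[of _ L']) blast
qed

lemma star_fq_prod:
  assumes "Fs \<noteq> []" "H \<in> Sym"
  shows "star f (fq_prod Fs) H = mu (star_tensor f (tensor Fs) (iter_coproduct (length Fs) H))"
proof -
  obtain r where r: "length Fs = Suc r" using assms(1) by (cases Fs) auto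
  obtain L where L: "\<forall>As\<in>set L. length As = Suc r \<and> set As \<subseteq> Sym"
    "iter_coproduct (Suc r) H = (\<Sum>As\<leftarrow>L. tensor As)"
    "\<forall>Fs. length Fs = Suc r \<longrightarrow> star f (fq_prod Fs) H = (\<Sum>As\<leftarrow>L. fq_prod (map2 (star f) Fs As))"
    using iter_coproduct_splitting[OF assms(2), of r f] by blast
  have "mu (star_tensor f (tensor Fs) (iter_coproduct (length Fs) H))
      = (\<Sum>As\<leftarrow>L. mu (star_tensor f (tensor Fs) (tensor As)))"
    by (simp only: r L(2) linear_map_sum_list[OF linear_map_star_tensor_right]
        linear_map_sum_list[OF linear_map_mu])
  also have "\<dots> = (\<Sum>As\<leftarrow>L. fq_prod (map2 (star f) Fs As))"
    using L(1) r by (intro arg_cong[where f = sum_list] map_cong refl) (simp add: star_tensor_tensor mu_tensor)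
  finally show ?thesis using L(3) r by simp
qed

section \<open>Products of monomial symmetric functions\<close>

abbreviation exponents :: "nat list \<Rightarrow> (nat \<Rightarrow>\<^sub>0 nat)" where
  "exponents u \<equiv> Poly_Mapping.nth u"

text \<open>Trailing zeros of a word are lost in its exponent vector; fixing the length restores
  them.\<close>

lemma exponents_inj:
  assumes "length u = length w" "exponents u = exponents w"
  shows "u = w"
proof (rule nth_equalityI)
  fix i assume "i < length u"
  then show "u ! i = w ! i"
    using arg_cong[OF assms(2), of "\<lambda>e. coef e i"] assms(1) by (simp add: nth_default_def)
qed (fact assms(1))

lemma exponents_eq:
  assumes "supp e \<subseteq> {..<n}"
  shows "e = exponents (map (coef e) [0..<n])"
proof (rule poly_mapping_eqI)
  fix i
  show "coef e i = coef (exponents (map (coef e) [0..<n])) i"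
    using assms by (cases "i < n") (auto simp: nth_default_def in_keys_iff subset_iff)
qed

lemma supp_exponents: "supp (exponents u) \<subseteq> {..<length u}"
proof
  fix i assume "i \<in> supp (exponents u)"
  then have "nth_default 0 u i \<noteq> 0" by (simp only: in_keys_iff lookup_nth not_False_eq_True)
  then show "i \<in> {..<length u}" by (auto simp: nth_default_def split: if_splits)
qed

lemma map_coef_exponents: "map (coef (exponents u)) [0..<length u] = u"
  by (rule nth_equalityI) (auto simp: nth_default_def)

text \<open>Exponent vectors in \<open>n\<close> letters are words of length \<open>n\<close>, and
  the partition, with zeros allowed, is the content of the word.\<close>

lemma monomial_sym_eq:
  assumes "size \<mu> = n"
  shows "monomial_sym n \<mu> = (\<Sum>u\<in>permutations_of_multiset \<mu>. Poly_Mapping.single (exponents u) 1)"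
proof -
  let ?E = "{e. supp e \<subseteq> {..<n} \<and> image_mset (coef e) (mset_set {..<n}) = \<mu>}"
  have ms: "image_mset (coef e) (mset_set {..<n}) = mset (map (coef e) [0..<n])" for e :: "nat \<Rightarrow>\<^sub>0 nat"
    by (simp add: atLeast0LessThan)
  have len: "length u = n" if "u \<in> permutations_of_multiset \<mu>" for u
    using permutations_of_multisetD[OF that] assms by auto
  have "?E = exponents ` permutations_of_multiset \<mu>"
  proof (intro equalityI subsetI)
    fix e assume e: "e \<in> ?E"
    then have "map (coef e) [0..<n] \<in> permutations_of_multiset \<mu>"
      unfolding ms by (intro permutations_of_multisetI) simp
    then show "e \<in> exponents ` permutations_of_multiset \<mu>"
      using exponents_eq[of e n] e by blast
  next
    fix e assume "e \<in> exponents ` permutations_of_multiset \<mu>"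
    then obtain u where u: "u \<in> permutations_of_multiset \<mu>" "e = exponents u" by blast
    then show "e \<in> ?E"
      unfolding ms using supp_exponents[of u] map_coef_exponents[of u] len[OF u(1)]
        permutations_of_multisetD[OF u(1)] by (simp del: mset_map)
  qed
  moreover have "inj_on exponents (permutations_of_multiset \<mu>)"
    by (rule inj_onI) (metis exponents_inj len)
  ultimately show ?thesis
    unfolding monomial_sym_def by (simp only: sum.reindex o_def)
qed

lemma coef_monomial_sym_exponents:
  assumes "size \<mu> = n" "length w = n"
  shows "coef (monomial_sym n \<mu>) (exponents w) = (if mset w = \<mu> then 1 else 0)"
proof -
  have len: "length u = n" if "u \<in> permutations_of_multiset \<mu>" for u
    using permutations_of_multisetD[OF that] assms by auto
  have "coef (monomial_sym n \<mu>) (exponents w) = (\<Sum>u\<in>permutations_of_multiset \<mu>. if u = w then 1 else 0)"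
    unfolding monomial_sym_eq[OF assms(1)] lookup_sum
    using exponents_inj len assms(2) by (intro sum.cong refl) (auto simp: lookup_single when_def)
  then show ?thesis
    by (simp only: sum.delta[OF finite_permutations_of_multiset]) (simp add: permutations_of_multiset_def)
qed

lemma coef_monomial_sym_zero:
  assumes "\<not> supp e \<subseteq> {..<n}"
  shows "coef (monomial_sym n \<mu>) e = 0"
  unfolding monomial_sym_def lookup_sum
  using assms by (intro sum.neutral) (auto simp: lookup_single when_def)

text \<open>The monomial of \<open>w\<close> occurs in exactly one monomial function, that of
  \<open>mset w\<close>, with coefficient 1.\<close>

lemma coef_monomial_expansion:
  assumes "\<forall>\<mu>\<in>supp a. size \<mu> = n" "length w = n"
  shows "coef (\<Sum>\<mu>\<in>supp a. scale (coef a \<mu>) (monomial_sym n \<mu>)) (exponents w) = coef a (mset w)"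
proof -
  have "coef (\<Sum>\<mu>\<in>supp a. scale (coef a \<mu>) (monomial_sym n \<mu>)) (exponents w)
      = (\<Sum>\<mu>\<in>supp a. coef a \<mu> * (if \<mu> = mset w then 1 else 0))"
    unfolding lookup_sum lookup_scale
    using assms by (intro sum.cong refl) (auto simp: coef_monomial_sym_exponents)
  then show ?thesis by (simp only: sum_coef_delta mult_1_right)
qed

text \<open>Resolves the definite description: reading coefficients at one monomial of each type
  shows that the expansion is unique.\<close>

lemma coef_monomial_coeffs:
  assumes "\<forall>\<mu>\<in>supp a. size \<mu> = n"
    and "p = (\<Sum>\<mu>\<in>supp a. scale (coef a \<mu>) (monomial_sym n \<mu>))"
    and "length w = n"
  shows "coef (monomial_coeffs n p) (mset w) = coef p (exponents w)"
proof -
  have "monomial_coeffs n p = a"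
    unfolding monomial_coeffs_def
  proof (rule the_equality)
    fix b assume b: "(\<forall>\<mu>\<in>supp b. size \<mu> = n) \<and> p = (\<Sum>\<mu>\<in>supp b. scale (coef b \<mu>) (monomial_sym n \<mu>))"
    show "b = a"
    proof (rule poly_mapping_eqI)
      fix \<mu>
      show "coef b \<mu> = coef a \<mu>"
      proof (cases "size \<mu> = n")
        case True
        obtain u where u: "mset u = \<mu>" using ex_mset by blast
        then have "length u = n" using True by auto
        then show ?thesis
          using coef_monomial_expansion[of b n u] coef_monomial_expansion[of a n u] b assms(1,2) u by metis
      next
        case False
        then show ?thesis using b assms(1) by (metis in_keys_iff)
      qed
    qed
  qed (use assms in blast)
  then show ?thesis
    using coef_monomial_expansion[OF assms(1,3)] assms(2) by simp
qed

lemma exponents_add: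
  assumes "length u = length u'"
  shows "exponents u + exponents u' = exponents (map2 (+) u' u)"
  by (rule poly_mapping_eqI) (auto simp: lookup_add nth_default_def assms)

lemma monomial_sym_mult:
  assumes "size \<alpha> = n" "size \<beta> = n"
  shows "monomial_sym n \<alpha> * monomial_sym n \<beta> = (\<Sum>(u, u')\<in>permutations_of_multiset \<alpha> \<times> permutations_of_multiset \<beta>.
    Poly_Mapping.single (exponents (map2 (+) u' u)) 1)"
proof -
  have "length u = length u'" if "u \<in> permutations_of_multiset \<alpha>" "u' \<in> permutations_of_multiset \<beta>" for u u'
    using permutations_of_multisetD[OF that(1)] permutations_of_multisetD[OF that(2)] assms by auto
  then show ?thesis
    unfolding monomial_sym_eq[OF assms(1)] monomial_sym_eq[OF assms(2)] sum_product sum.cartesian_product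
    by (intro sum.cong refl) (auto simp: mult_single exponents_add)
qed

text \<open>Multiplying monomials adds exponent vectors place by place, so a coefficient counts the
  ways of writing \<open>w\<close> as a sum of words of types \<alpha> and \<beta>.\<close>

lemma coef_monomial_sym_mult:
  assumes "size \<alpha> = n" "size \<beta> = n" "length w = n"
  shows "coef (monomial_sym n \<alpha> * monomial_sym n \<beta>) (exponents w) = int (pointwise_count (+) \<alpha> \<beta> w)"
proof -
  let ?A = "permutations_of_multiset \<alpha> \<times> permutations_of_multiset \<beta>"
  have len: "length (map2 (+) u' u) = n" if "u \<in> permutations_of_multiset \<alpha>" "u' \<in> permutations_of_multiset \<beta>" for u u'
    using permutations_of_multisetD[OF that(1)] permutations_of_multisetD[OF that(2)] assms by auto
  have "coef (monomial_sym n \<alpha> * monomial_sym n \<beta>) (exponents w)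
      = (\<Sum>z\<in>?A. if map2 (+) (snd z) (fst z) = w then 1 else 0)"
    unfolding monomial_sym_mult[OF assms(1,2)] lookup_sum
  proof (rule sum.cong[OF refl])
    fix z assume "z \<in> ?A"
    then obtain u u' where z: "z = (u, u')" "u \<in> permutations_of_multiset \<alpha>" "u' \<in> permutations_of_multiset \<beta>"
      by auto
    have "exponents (map2 (+) u' u) = exponents w \<longleftrightarrow> map2 (+) u' u = w"
      using exponents_inj len[OF z(2,3)] assms(3) by metis
    then show "coef (case z of (u, u') \<Rightarrow> Poly_Mapping.single (exponents (map2 (+) u' u)) 1) (exponents w)
        = (if map2 (+) (snd z) (fst z) = w then 1 else 0 :: int)"
      by (simp only: z(1) case_prod_conv lookup_single when_def fst_conv snd_conv)
  qed
  also have "\<dots> = int (card {z \<in> ?A. map2 (+) (snd z) (fst z) = w})"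
    by (simp add: sum.inter_filter[symmetric])
  also have "{z \<in> ?A. map2 (+) (snd z) (fst z) = w} = {(u, u'). u \<in> permutations_of_multiset \<alpha> \<and>
     u' \<in> permutations_of_multiset \<beta> \<and> map2 (+) u' u = w}" by auto
  finally show ?thesis unfolding pointwise_count_def .
qed

abbreviation sum_types :: "nat multiset \<Rightarrow> nat multiset \<Rightarrow> nat multiset set" where
  "sum_types \<alpha> \<beta> \<equiv>
    (\<lambda>(u, u'). mset (map2 (+) u' u)) ` (permutations_of_multiset \<alpha> \<times> permutations_of_multiset \<beta>)"

lemma pointwise_count_eq_0:
  assumes "mset w \<notin> sum_types \<alpha> \<beta>"
  shows "pointwise_count (+) \<alpha> \<beta> w = 0"
proof -
  have "{(u, u'). u \<in> permutations_of_multiset \<alpha> \<and> u' \<in> permutations_of_multiset \<beta> \<and> map2 (+) u' u = w} = {}"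
    using assms by force
  then show ?thesis unfolding pointwise_count_def by (simp only: card.empty)
qed

lemma d_coeff_eq:
  assumes "weight i = n" "weight j = n" "mset w = content v" "length w = n"
  shows "d_coeff n i j v = int (pointwise_count (+) (content i) (content j) w)"
proof -
  let ?\<alpha> = "content i" and ?\<beta> = "content j"
  let ?M = "sum_types ?\<alpha> ?\<beta>"
  have size: "size ?\<alpha> = n" "size ?\<beta> = n" using assms by (simp_all add: size_content)
  have sizeM: "size M = n" if "M \<in> ?M" for M
  proof -
    obtain u u' where u: "mset u = ?\<alpha>" "mset u' = ?\<beta>" "M = mset (map2 (+) u' u)"
      using \<open>M \<in> ?M\<close> by (auto simp: permutations_of_multiset_def simp del: mset_map)
    then have "length u = n" "length u' = n" using size by (metis size_mset)+
    then show ?thesis by (simp add: u(3) del: mset_map)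
  qed
  \<comment> \<open>An explicit expansion of the product is needed to evaluate the description in
    \<open>monomial_coeffs\<close>. Its coefficients are counts at arbitrary representatives, which
    is legitimate by \<open>pointwise_count_cong\<close>.\<close>
  define a where "a = (\<Sum>M\<in>?M. Poly_Mapping.single M (int (pointwise_count (+) ?\<alpha> ?\<beta> (SOME w. mset w = M))))"
  have coef_a: "coef a M = (if M \<in> ?M then int (pointwise_count (+) ?\<alpha> ?\<beta> (SOME w. mset w = M)) else 0)" for M
    unfolding a_def lookup_sum lookup_single when_def by (rule sum.delta) simp
  have a: "\<forall>M\<in>supp a. size M = n"
    using sizeM by (auto simp: in_keys_iff coef_a simp del: mset_map split: if_splits)
  have coef_a_mset: "coef a (mset u) = int (pointwise_count (+) ?\<alpha> ?\<beta> u)" for u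
  proof (cases "mset u \<in> ?M")
    case True
    have "mset (SOME w. mset w = mset u) = mset u" by (rule someI[of _ u]) simp
    then have "pointwise_count (+) ?\<alpha> ?\<beta> (SOME w. mset w = mset u) = pointwise_count (+) ?\<alpha> ?\<beta> u"
      using size by (intro pointwise_count_cong) simp_all
    then show ?thesis using True by (simp only: coef_a if_True)
  next
    case False
    then show ?thesis by (simp only: coef_a if_False pointwise_count_eq_0[OF False] of_nat_0)
  qed
  have "monomial_sym n ?\<alpha> * monomial_sym n ?\<beta> = (\<Sum>\<mu>\<in>supp a. scale (coef a \<mu>) (monomial_sym n \<mu>))"
  proof (rule poly_mapping_eqI)
    fix e
    show "coef (monomial_sym n ?\<alpha> * monomial_sym n ?\<beta>) e
        = coef (\<Sum>\<mu>\<in>supp a. scale (coef a \<mu>) (monomial_sym n \<mu>)) e"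
    proof (cases "supp e \<subseteq> {..<n}")
      case True
      define u where "u = map (coef e) [0..<n]"
      have u: "e = exponents u" "length u = n" using exponents_eq[OF True] by (simp_all add: u_def)
      show ?thesis
        unfolding u(1) coef_monomial_expansion[OF a u(2)] coef_monomial_sym_mult[OF size u(2)]
        by (simp only: coef_a_mset)
    next
      case False
      have "coef (monomial_sym n ?\<alpha> * monomial_sym n ?\<beta>) e = 0"
        unfolding monomial_sym_mult[OF size] lookup_sum
      proof (rule sum.neutral, rule ballI)
        fix z assume "z \<in> permutations_of_multiset ?\<alpha> \<times> permutations_of_multiset ?\<beta>"
        then obtain u u' where z: "z = (u, u')" "u \<in> permutations_of_multiset ?\<alpha>" "u' \<in> permutations_of_multiset ?\<beta>"
          by auto
        have "length (map2 (+) u' u) = n"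
          using permutations_of_multisetD[OF z(2)] permutations_of_multisetD[OF z(3)] size
          by (metis length_map length_zip min.idem size_mset)
        then have "exponents (map2 (+) u' u) \<noteq> e" using supp_exponents False by metis
        then show "coef (case z of (u, u') \<Rightarrow> Poly_Mapping.single (exponents (map2 (+) u' u)) 1) e = (0 :: int)"
          by (simp add: z(1) lookup_single when_def)
      qed
      then show ?thesis by (simp add: lookup_sum coef_monomial_sym_zero[OF False])
    qed
  qed
  then have "coef (monomial_coeffs n (monomial_sym n ?\<alpha> * monomial_sym n ?\<beta>)) (mset w)
      = int (pointwise_count (+) ?\<alpha> ?\<beta> w)"
    using coef_monomial_coeffs[OF a _ assms(4)] coef_monomial_sym_mult[OF size assms(4)] by metis
  \<comment> \<open>For natural numbers as colors, \<open>partition_of\<close> and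
    \<open>content\<close> have the same defining sum.\<close>
  then show ?thesis
    by (simp add: d_coeff_def partition_of_def content_def[symmetric] assms(3))
qed

lemma content_inj: "content v = content v' \<Longrightarrow> v = v'"
  by (rule poly_mapping_eqI) (metis count_content)

text \<open>There are in general infinitely many vectors of weight \<open>n\<close>, and a sum over
  an infinite set is 0. Requiring a nonzero coefficient leaves only vectors whose content lies in
  the finite set \<open>sum_types (content i) (content j)\<close>.\<close>

lemma star_S_S_nat:
  assumes "weight i = n" "weight j = n"
  shows "star (+) (S i :: (nat, 'k::comm_ring_1) fqsym) (S j) =
    (\<Sum>v\<in>{v. weight v = n \<and> d_coeff n i j v \<noteq> 0}. scale (of_int (d_coeff n i j v)) (S v))"
proof -
  let ?\<alpha> = "content i" and ?\<beta> = "content j" and ?V = "{v. weight v = n \<and> d_coeff n i j v \<noteq> 0}"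
  let ?c = "\<lambda>M. pointwise_count (+) ?\<alpha> ?\<beta> (SOME w. mset w = M)"
  have size: "size ?\<alpha> = size ?\<beta>" using assms by (simp add: size_content)
  have some: "mset (SOME w. mset w = M) = M" for M :: "nat multiset"
    by (rule someI_ex[OF ex_mset])
  have d: "d_coeff n i j v = int (?c (content v))" if "weight v = n" for v
    using that assms some[of "content v"]
    by (intro d_coeff_eq) (auto simp: size_content dest: arg_cong[of _ _ size])
  have "finite (sum_types ?\<alpha> ?\<beta>)" by simp
  have "star (+) (S i :: (nat, 'k) fqsym) (S j) = (\<Sum>M\<in>sum_types ?\<alpha> ?\<beta>. scale (of_nat (?c M)) (complete_fn M))"
    unfolding S_eq_complete
  proof (rule star_complete_size_eq[OF size \<open>finite (sum_types ?\<alpha> ?\<beta>)\<close>])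
    fix u u' assume "mset u = ?\<alpha>" "mset u' = ?\<beta>"
    then show "mset (map2 (+) u' u) \<in> sum_types ?\<alpha> ?\<beta>"
      by (intro image_eqI[of _ _ "(u, u')"]) (simp_all add: permutations_of_multiset_def)
  qed
  also have "\<dots> = (\<Sum>M\<in>content ` ?V. scale (of_nat (?c M)) (complete_fn M))"
  proof (rule sum.mono_neutral_right)
    show "content ` ?V \<subseteq> sum_types ?\<alpha> ?\<beta>"
    proof
      fix M assume "M \<in> content ` ?V"
      then have "?c M \<noteq> 0" using d by auto
      then show "M \<in> sum_types ?\<alpha> ?\<beta>" using pointwise_count_eq_0 some by metis
    qed
    show "\<forall>M\<in>sum_types ?\<alpha> ?\<beta> - content ` ?V. scale (of_nat (?c M)) (complete_fn M) = (0 :: (nat, 'k) fqsym)"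
    proof
      fix M assume M: "M \<in> sum_types ?\<alpha> ?\<beta> - content ` ?V"
      then obtain u u' where u: "mset u = ?\<alpha>" "mset u' = ?\<beta>" "M = mset (map2 (+) u' u)"
        by (auto simp: permutations_of_multiset_def simp del: mset_map)
      obtain v where v: "content v = M" using content_surj by blast
      have "length u = n" "length u' = n" using assms u by (metis size_mset size_content)+
      then have "size M = n" by (simp add: u(3) del: mset_map)
      then have "weight v = n" using v size_content by metis
      then have "?c M = 0" using M v d by force
      then show "scale (of_nat (?c M)) (complete_fn M) = (0 :: (nat, 'k) fqsym)" by simp
    qed
  qed fact
  also have "\<dots> = (\<Sum>v\<in>?V. scale (of_nat (?c (content v))) (complete_fn (content v)))"
    by (subst sum.reindex) (auto intro!: inj_onI dest: content_inj)
  also have "\<dots> = (\<Sum>v\<in>?V. scale (of_int (d_coeff n i j v)) (S v))"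
    by (rule sum.cong) (auto simp: d S_eq_complete)
  finally show ?thesis .
qed

theorem theorem5p8:
  fixes f :: "'c \<Rightarrow> 'c \<Rightarrow> 'c"
  assumes "abel_semigroup f"
  shows
    "(\<forall>n. is_subalgebra (star f) (Sym_deg n :: ('c, 'k::comm_ring_1) fqsym set))
   \<and> (\<forall>(Fs :: ('c, 'k) fqsym list) (H :: ('c, 'k) fqsym).
        Fs \<noteq> [] \<longrightarrow> set Fs \<subseteq> Sym \<longrightarrow> H \<in> Sym \<longrightarrow>
        star f (fq_prod Fs) H =
          mu (star_tensor f (tensor Fs) (iter_coproduct (length Fs) H)))
   \<and> (\<forall>n (i :: nat \<Rightarrow>\<^sub>0 nat) (j :: nat \<Rightarrow>\<^sub>0 nat). weight i = n \<longrightarrow> weight j = n \<longrightarrow>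
        star ((+) :: nat \<Rightarrow> nat \<Rightarrow> nat) (S i :: (nat, 'k) fqsym) (S j) =
          (\<Sum>v\<in>{v. weight v = n \<and> d_coeff n i j v \<noteq> 0}. scale (of_int (d_coeff n i j v)) (S v)))
   \<and> (\<forall>(i :: 'c \<Rightarrow>\<^sub>0 nat) J. vector_composition J \<longrightarrow>
        star f (S i :: ('c, 'k) fqsym) (S_comp J) = star f (S_comp J) (S i))"
proof -
  have comm: "f a b = f b a" for a b
    using abel_semigroup.commute[OF assms] .
  show ?thesis
  proof (intro conjI allI impI)
    show "is_subalgebra (star f) (Sym_deg n :: ('c, 'k) fqsym set)" for n
      by (rule subalgebra_Sym_deg) (rule comm)
    show "star f (S i :: ('c, 'k) fqsym) (S_comp J) = star f (S_comp J) (S i)" for i J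
      unfolding S_eq_complete by (rule star_complete_commute) (rule comm)
  qed (blast intro: star_fq_prod star_S_S_nat)+
qed

end
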